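(* Let $d,D\ge 1$, let $0<L_1<\cdots<L_D$, and let $(\boldsymbol{x}_1,y_1),\ldots,(\boldsymbol{x}_T,y_T)\in\mathcal{X}\times[0,1]$ be an arbitrary sequence, fixed in advance. Suppose the Locally Adaptive Online Learning algorithm (Hedge style, with the subroutine propagate, both described in the context) is run for $T$ rounds with square loss $\ell_t(y)=\frac12(y_t-y)^2$, with Follow-the-Leader as local learner at each node, and with radius tuning function $$\rho(k,t)=(L_k t)^{-\frac{1}{d+1}},$$ and let $\mathcal{T}$ be the resulting hierarchical net (tree). Then for all prunings $E$ of $\mathcal{T}$ the regret $R_T(f)=\sum_{t=1}^T\big(\ell_t(\widehat y_t)-\ell_t(f(\boldsymbol{x}_t))\big)$ satisfies $$R_T(f)=\widetilde{\mathcal{O}}\left(\mathbb{E}\Big[L_K^{\frac{d}{d+1}}\Big]\,T^{\frac{d}{d+1}}+\sum_{k=1}^D\big(L_k\,T_{E,k}\big)^{\frac{d}{d+1}}\right)\qquad\text{for all } f\in\mathcal{F}(E,\mathcal{T}),$$ where the expectation is with respect to the random variable $K$ with $\mathbb{P}(K=k)=|E_k|/|E|$, i.e. the fraction of leaves of $E$ that are at level $k$.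
   Context: Setting. $\mathcal{X}\subset\mathbb{R}^d$ is the closed unit ball of a fixed but arbitrary norm $\|\cdot\|$; $\mathcal{B}(\boldsymbol{z},r)$ is the ball of center $\boldsymbol{z}$ and radius $r$. In each round $t=1,2,\ldots$ the learner sees $\boldsymbol{x}_t$, predicts $\widehat y_t\in[0,1]$, then observes $y_t$ and incurs loss $\ell_t(\widehat y_t)$. Subroutine propagate. The algorithm keeps sets of centers $S_1,\ldots,S_D\subseteq\{1,2,\ldots\}$ (initially empty), where $s\in S_k$ denotes a level-$k$ node centered at $\boldsymbol{x}_s$ and hosting its own local learner (a separate one for each level). In round $t$ set $\mathcal{B}_{\rm parent}=\mathcal{X}$ and for $k=1,\ldots,D$ do: if $S_k=\varnothing$, set $S_k=\{t\}$ and create a learner at $\boldsymbol{x}_t$; let $\varepsilon=\rho(k,t)$ and let $s$ minimize $\|\boldsymbol{x}_i-\boldsymbol{x}_t\|$ over $i\in S_k$ with $\boldsymbol{x}_i\in\mathcal{B}_{\rm parent}$; if $\|\boldsymbol{x}_t-\boldsymbol{x}_s\|\le\varepsilon$ set $\pi_k=s$; otherwise (or if there is no such center) add $t$ to $S_k$, create a learner at $\boldsymbol{x}_t$, and set $\pi_k=t$; finally set $\mathcal{B}_{\rm parent}=\mathcal{B}(\boldsymbol{x}_{\pi_k},\varepsilon)$. The nodes $\boldsymbol{\pi}_t=(\pi_1,\ldots,\pi_D)$ (one per level) are the active nodes of round $t$. Hedge-style aggregation. Every node $v$ has weight $1$ when created. In round $t$, with $\widehat y_{v,t}$ the prediction of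 the local learner at active node $v$ and all sums over the active nodes, predict $\widehat y_t=\frac1{W_{t-1}}\sum_v w_{v,t-1}\widehat y_{v,t}$ with $W_{t-1}=\sum_v w_{v,t-1}$. After observing $y_t$, update the local learners at active nodes with $(\boldsymbol{x}_t,y_t)$, and for each active $v$ set $w_{v,t}=w_{v,t-1}e^{-\frac12\ell_t(\widehat y_{v,t})}/Z_{t-1}$ with $Z_{t-1}=\frac1{W_{t-1}}\sum_v w_{v,t-1}e^{-\frac12\ell_t(\widehat y_{v,t})}$. Inactive nodes are unchanged. Follow-the-Leader at a node predicts a minimizer over $y\in[0,1]$ of the sum of $\ell_s(y)$ over the past rounds $s$ in which the node was active (arbitrary value in $[0,1]$ if there are none). Tree and prunings. After $T$ rounds, $\mathcal{T}$ is the rooted tree whose root is $\mathcal{X}$ (level $0$, no learner) and whose level-$k$ nodes are the elements of $S_k$; the parent of a node is the node preceding it on the path $\boldsymbol{\pi}_t$ of the round $t$ in which it was created. Each $\boldsymbol{\pi}_t$ is regarded as a root-to-leaf path. A pruning $E$ of $\mathcal{T}$ is obtained by zero or more operations, each deleting the subtree below an internal node while keeping that node (which becomes a leaf). $E_k=\mathrm{leaves}_k(\mathcal{T},E)\subseteq S_k$ is the set of leaves of $E$ at level $k$, and $|E|=|E_1|+\cdots+|E_D|$ (the leaves considered are at levels $1,\ldots,D$). Each round $t$ is associated with the unique leaf of $E$ lying on $\boldsymbol{\pi}_t$; $T_{E,k}$ is the number of rounds $t\le T$ whose associated leaf is at level $k$. Admissible functions. $\mathcal{F}(E,\mathcal{T})$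 is the set of $f:\mathcal{X}\to[0,1]$ such that for all $k=1,\ldots,D$, all $t=1,\ldots,T$, all $i\in\mathrm{leaves}_k(\mathcal{T},E)$ and all $\boldsymbol{x}\in\mathcal{B}(\boldsymbol{x}_i,\rho(k,t))$: $|f(\boldsymbol{x}_i)-f(\boldsymbol{x})|\le L_k\,\rho(k,t)$. Notation $\widetilde{\mathcal{O}}$: an upper bound up to a multiplicative constant and factors polylogarithmic in $T$, for all $T\ge T_0$. The constants may depend on $d$, $D$ and the norm, and $T_0$ also on $L_1,\ldots,L_D$, but they do not depend on the data sequence, $E$ or $f$.
   Formalization: It is assumed that on each path π_t there is exactly one leaf of E (at levels 1..D); this can fail for the algorithm as described, and then the leaf associated with round t, hence T_{E,k}, is undefined. The pruning consisting of the root alone (|E|=0) is thereby excluded. *)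

theory Defs
  imports "HOL-Probability.Probability"
begin

section \<open>Arbitrary norms on Euclidean space\<close>

definition is_norm :: "('a::real_vector \<Rightarrow> real) \<Rightarrow> bool" where
  "is_norm N \<longleftrightarrow>
     (\<forall>x. 0 \<le> N x) \<and> (\<forall>x. N x = 0 \<longleftrightarrow> x = 0) \<and>
     (\<forall>c x. N (c *\<^sub>R x) = \<bar>c\<bar> * N x) \<and>
     (\<forall>x y. N (x + y) \<le> N x + N y)"

definition norm_ball :: "('a::real_vector \<Rightarrow> real) \<Rightarrow> 'a \<Rightarrow> real \<Rightarrow> 'a set" where
  "norm_ball N c r = {z. N (z - c) \<le> r}"

section \<open>The subroutine propagate\<close>

text \<open>
  The procedure is a relation, so that ties between nearest centers are broken arbitrarily.
  \<open>propagate_step N x t B \<epsilon> C C' s\<close> is one pass of its inner loop, in round \<open>t\<close>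
  with parent ball \<open>B\<close> and radius \<open>\<epsilon>\<close>: it turns the set of centers \<open>C\<close> into \<open>C'\<close> and
  selects \<open>s\<close>.
\<close>

definition propagate_step ::
  "('a::real_vector \<Rightarrow> real) \<Rightarrow> (nat \<Rightarrow> 'a) \<Rightarrow> nat \<Rightarrow> 'a set \<Rightarrow> real \<Rightarrow>
   nat set \<Rightarrow> nat set \<Rightarrow> nat \<Rightarrow> bool" where
  "propagate_step N x t B \<epsilon> C C' s \<longleftrightarrow>
     (let C1 = (if C = {} then {t} else C);
          nearest = is_arg_min (\<lambda>i. N (x i - x t)) (\<lambda>i. i \<in> C1 \<and> x i \<in> B)
      in (nearest s \<and> N (x t - x s) \<le> \<epsilon> \<and> C' = C1) \<or>
         (((\<exists>i. nearest i \<and> \<not> N (x t - x i) \<le> \<epsilon>) \<or> (\<forall>i\<in>C1. x i \<notin> B)) \<and>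
          s = t \<and> C' = insert t C1))"

text \<open>
  \<open>S t k\<close> is the set of level-\<open>k\<close> centers at the end of round \<open>t\<close> and \<open>\<pi> t k\<close> is the
  (center of the) active level-\<open>k\<close> node of round \<open>t\<close>.
\<close>

definition parent_ball ::
  "('a::real_vector \<Rightarrow> real) \<Rightarrow> (nat \<Rightarrow> nat \<Rightarrow> real) \<Rightarrow> (nat \<Rightarrow> 'a) \<Rightarrow>
   (nat \<Rightarrow> nat \<Rightarrow> nat) \<Rightarrow> nat \<Rightarrow> nat \<Rightarrow> 'a set" where
  "parent_ball N \<rho> x \<pi> t k =
     (if k = 1 then norm_ball N 0 1 else norm_ball N (x (\<pi> t (k - 1))) (\<rho> (k - 1) t))"

definition propagate_run ::
  "('a::real_vector \<Rightarrow> real) \<Rightarrow> (nat \<Rightarrow> nat \<Rightarrow> real) \<Rightarrow> nat \<Rightarrow> nat \<Rightarrow> (nat \<Rightarrow> 'a) \<Rightarrow>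
   (nat \<Rightarrow> nat \<Rightarrow> nat set) \<Rightarrow> (nat \<Rightarrow> nat \<Rightarrow> nat) \<Rightarrow> bool" where
  "propagate_run N \<rho> D T x S \<pi> \<longleftrightarrow>
     (\<forall>k\<in>{1..D}. S 0 k = {}) \<and>
     (\<forall>t\<in>{1..T}. \<forall>k\<in>{1..D}.
        propagate_step N x t (parent_ball N \<rho> x \<pi> t k) (\<rho> k t) (S (t - 1) k) (S t k) (\<pi> t k))"

section \<open>Nodes, local learners and Hedge-style aggregation\<close>

text \<open>\<open>Node k s\<close> is the level-\<open>k\<close> node centered at \<open>x s\<close>; it was created in round \<open>s\<close>.\<close>

datatype node = Root | Node nat nat

definition active_nodes :: "nat \<Rightarrow> (nat \<Rightarrow> nat \<Rightarrow> nat) \<Rightarrow> nat \<Rightarrow> node set" where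
  "active_nodes D \<pi> t = (\<lambda>k. Node k (\<pi> t k)) ` {1..D}"

definition square_loss :: "(nat \<Rightarrow> real) \<Rightarrow> nat \<Rightarrow> real \<Rightarrow> real" where
  "square_loss y t z = (y t - z)\<^sup>2 / 2"

text \<open>
  \<open>A t\<close> is the set of active nodes and \<open>p t v\<close> the prediction of the local learner at \<open>v\<close> in
  round \<open>t\<close>. When \<open>v\<close> has not been active before, the sum is empty and every value in
  \<open>[0,1]\<close> is allowed.
\<close>

definition follow_the_leader ::
  "(nat \<Rightarrow> real \<Rightarrow> real) \<Rightarrow> (nat \<Rightarrow> node set) \<Rightarrow> nat \<Rightarrow> (nat \<Rightarrow> node \<Rightarrow> real) \<Rightarrow> bool" where
  "follow_the_leader \<l> A T p \<longleftrightarrow>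
     (\<forall>t\<in>{1..T}. \<forall>v\<in>A t.
        is_arg_min (\<lambda>z. \<Sum>s\<in>{s\<in>{1..<t}. v \<in> A s}. \<l> s z) (\<lambda>z. z \<in> {0..1}) (p t v))"

text \<open>
  A node is active for the first time in the round of its creation, so giving weight 1 to all
  potential nodes at time 0 is the same as giving each node weight 1 when it is created.
\<close>

fun hedge_weight ::
  "(nat \<Rightarrow> real \<Rightarrow> real) \<Rightarrow> (nat \<Rightarrow> node set) \<Rightarrow> (nat \<Rightarrow> node \<Rightarrow> real) \<Rightarrow> nat \<Rightarrow> node \<Rightarrow> real"
where
  "hedge_weight \<l> A p 0 v = 1"
| "hedge_weight \<l> A p (Suc t) v =
     (let w = hedge_weight \<l> A p t;
          W = (\<Sum>u\<in>A (Suc t). w u);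
          Z = (1 / W) * (\<Sum>u\<in>A (Suc t). w u * exp (- (1/2) * \<l> (Suc t) (p (Suc t) u)))
      in if v \<in> A (Suc t) then w v * exp (- (1/2) * \<l> (Suc t) (p (Suc t) v)) / Z else w v)"

definition hedge_prediction ::
  "(nat \<Rightarrow> real \<Rightarrow> real) \<Rightarrow> (nat \<Rightarrow> node set) \<Rightarrow> (nat \<Rightarrow> node \<Rightarrow> real) \<Rightarrow> nat \<Rightarrow> real" where
  "hedge_prediction \<l> A p t =
     (1 / (\<Sum>v\<in>A t. hedge_weight \<l> A p (t - 1) v)) *
     (\<Sum>v\<in>A t. hedge_weight \<l> A p (t - 1) v * p t v)"

section \<open>The tree and its prunings\<close>

text \<open>
  \<open>C k\<close> is the final set of level-\<open>k\<close> centers. Edges point from parent to child; the parent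
  of \<open>Node k s\<close> is read off the path \<open>\<pi> s\<close> of the round \<open>s\<close> that created it.
\<close>

definition tree_nodes :: "nat \<Rightarrow> (nat \<Rightarrow> nat set) \<Rightarrow> node set" where
  "tree_nodes D C = insert Root {Node k s | k s. k \<in> {1..D} \<and> s \<in> C k}"

definition tree_edges ::
  "nat \<Rightarrow> (nat \<Rightarrow> nat set) \<Rightarrow> (nat \<Rightarrow> nat \<Rightarrow> nat) \<Rightarrow> (node \<times> node) set" where
  "tree_edges D C \<pi> =
     {(if k = 1 then Root else Node (k - 1) (\<pi> s (k - 1)), Node k s) | k s. k \<in> {1..D} \<and> s \<in> C k}"

inductive pruning :: "node set \<Rightarrow> (node \<times> node) set \<Rightarrow> node set \<Rightarrow> bool"
  for V :: "node set" and R :: "(node \<times> node) set" where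
  full: "pruning V R V"
| cut: "pruning V R (E - R\<^sup>+ `` {v})" if "pruning V R E" "v \<in> E" "\<exists>u\<in>E. (v, u) \<in> R"

definition leaves :: "(node \<times> node) set \<Rightarrow> node set \<Rightarrow> node set" where
  "leaves R E = {v \<in> E. \<forall>u\<in>E. (v, u) \<notin> R}"

definition leaves_at :: "(node \<times> node) set \<Rightarrow> node set \<Rightarrow> nat \<Rightarrow> nat set" where
  "leaves_at R E k = {s. Node k s \<in> leaves R E}"

definition num_leaves :: "nat \<Rightarrow> (node \<times> node) set \<Rightarrow> node set \<Rightarrow> nat" where
  "num_leaves D R E = (\<Sum>k=1..D. card (leaves_at R E k))"

text \<open>
  Every round has a well-defined associated leaf. Because centers are searched in the parent
  ball rather than among the children of the parent node, propagate may reach a node through a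
  level-\<open>(k - 1)\<close> node that is not its parent, and then \<open>\<pi> t\<close> is not a path of the tree. If
  all \<open>\<pi> t\<close> are paths, the condition holds for every pruning except the one consisting of the
  root alone; see \<open>rounds_have_leaf_if_paths\<close> below.
\<close>

definition rounds_have_leaf ::
  "nat \<Rightarrow> nat \<Rightarrow> (nat \<Rightarrow> nat \<Rightarrow> nat) \<Rightarrow> (node \<times> node) set \<Rightarrow> node set \<Rightarrow> bool" where
  "rounds_have_leaf D T \<pi> R E \<longleftrightarrow> (\<forall>t\<in>{1..T}. \<exists>!v. v \<in> leaves R E \<and> v \<in> active_nodes D \<pi> t)"

definition associated_leaf ::
  "nat \<Rightarrow> (nat \<Rightarrow> nat \<Rightarrow> nat) \<Rightarrow> (node \<times> node) set \<Rightarrow> node set \<Rightarrow> nat \<Rightarrow> node" where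
  "associated_leaf D \<pi> R E t = (THE v. v \<in> leaves R E \<and> v \<in> active_nodes D \<pi> t)"

definition rounds_at_level ::
  "nat \<Rightarrow> nat \<Rightarrow> (nat \<Rightarrow> nat \<Rightarrow> nat) \<Rightarrow> (node \<times> node) set \<Rightarrow> node set \<Rightarrow> nat \<Rightarrow> nat" where
  "rounds_at_level D T \<pi> R E k = card {t\<in>{1..T}. \<exists>s. associated_leaf D \<pi> R E t = Node k s}"

definition leaf_level_pmf :: "nat \<Rightarrow> (node \<times> node) set \<Rightarrow> node set \<Rightarrow> nat pmf" where
  "leaf_level_pmf D R E =
     embed_pmf (\<lambda>k. if k \<in> {1..D} then card (leaves_at R E k) / num_leaves D R E else 0)"

lemma pmf_leaf_level_pmf:
  assumes "num_leaves D R E \<noteq> 0"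
  shows "pmf (leaf_level_pmf D R E) k =
           (if k \<in> {1..D} then card (leaves_at R E k) / num_leaves D R E else 0)"
  unfolding leaf_level_pmf_def
proof (rule pmf_embed_pmf)
  let ?q = "\<lambda>k. if k \<in> {1..D} then card (leaves_at R E k) / num_leaves D R E else (0::real)"
  have "(\<integral>\<^sup>+ k. ennreal (?q k) \<partial>count_space UNIV) = (\<Sum>k\<in>{1..D}. ennreal (?q k))"
    by (rule nn_integral_count_space') auto
  also have "\<dots> = ennreal (\<Sum>k\<in>{1..D}. ?q k)"
    by (rule sum_ennreal) auto
  also have "(\<Sum>k\<in>{1..D}. ?q k) = 1"
    using assms by (simp add: num_leaves_def sum_divide_distrib [symmetric] flip: of_nat_sum)
  finally show "(\<integral>\<^sup>+ k. ennreal (?q k) \<partial>count_space UNIV) = 1" by simp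
qed auto

lemma pruning_invariants:
  assumes "pruning V R E" "R \<subseteq> V \<times> V" "Root \<in> V" "\<And>u. (u, Root) \<notin> R"
    and single: "\<And>u u' v. (u, v) \<in> R \<Longrightarrow> (u', v) \<in> R \<Longrightarrow> u = u'"
  shows "Root \<in> E \<and> E \<subseteq> V \<and> (\<forall>u v. (u, v) \<in> R \<longrightarrow> v \<in> E \<longrightarrow> u \<in> E) \<and>
    (\<forall>u v v'. (u, v) \<in> R \<longrightarrow> (u, v') \<in> R \<longrightarrow> v \<in> E \<longrightarrow> v' \<in> E)"
  using assms(1)
proof induction
  case full
  show ?case using assms(2,3) by blast
next
  case (cut E w)
  have root: "(w, Root) \<notin> R\<^sup>+"
    by (metis assms(4) tranclE)
  have down: "(w, v) \<in> R\<^sup>+" if "(w, u) \<in> R\<^sup>+" "(u, v) \<in> R" for u v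
    using that by (rule trancl_into_trancl)
  have sib: "(w, v) \<in> R\<^sup>+" if "(w, v') \<in> R\<^sup>+" "(u, v) \<in> R" "(u, v') \<in> R" for u v v'
    using that(1)
  proof (cases rule: tranclE)
    case base
    then show ?thesis using single that by blast
  next
    case (step c)
    then have "c = u" using single that(3) by blast
    then show ?thesis using step(1) that(2) down by blast
  qed
  have 1: "Root \<in> E - R\<^sup>+ `` {w}" and 2: "E - R\<^sup>+ `` {w} \<subseteq> V"
    using cut.IH root by auto
  have 3: "u \<in> E - R\<^sup>+ `` {w}" if "(u, v) \<in> R" "v \<in> E - R\<^sup>+ `` {w}" for u v
    using cut.IH down that by blast
  have 4: "v' \<in> E - R\<^sup>+ `` {w}" if "(u, v) \<in> R" "(u, v') \<in> R" "v \<in> E - R\<^sup>+ `` {w}" for u v v'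
  proof -
    have "v' \<in> E" using cut.IH that by blast
    moreover have "(w, v') \<notin> R\<^sup>+" using sib that by blast
    ultimately show ?thesis by blast
  qed
  show ?case using 1 2 3 4 by blast
qed

lemma rounds_have_leaf_if_paths:
  assumes run: "propagate_run N \<rho> D T x S \<pi>" and D: "1 \<le> D"
    and paths: "\<And>t k. t \<in> {1..T} \<Longrightarrow> k \<in> {1..<D} \<Longrightarrow>
      (Node k (\<pi> t k), Node (Suc k) (\<pi> t (Suc k))) \<in> tree_edges D (S T) \<pi>"
    and E: "pruning (tree_nodes D (S T)) (tree_edges D (S T) \<pi>) E" "E \<noteq> {Root}"
  shows "rounds_have_leaf D T \<pi> (tree_edges D (S T) \<pi>) E"
proof -
  let ?V = "tree_nodes D (S T)" and ?R = "tree_edges D (S T) \<pi>"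
  have step: "propagate_step N x t (parent_ball N \<rho> x \<pi> t k) (\<rho> k t) (S (t - 1) k) (S t k) (\<pi> t k)"
    if "t \<in> {1..T}" "k \<in> {1..D}" for t k
    using run that by (auto simp: propagate_run_def)
  have mono1: "S (t - 1) k \<subseteq> S t k" and mem: "\<pi> t k \<in> S t k"
    and new: "S t k \<subseteq> insert t (S (t - 1) k)"
    if "t \<in> {1..T}" "k \<in> {1..D}" for t k
    using step [OF that]
    by (auto simp: propagate_step_def Let_def is_arg_min_def split: if_splits)
  have mono: "t \<le> T' \<Longrightarrow> T' \<le> T \<Longrightarrow> S t k \<subseteq> S T' k" if "k \<in> {1..D}" for t T' k
  proof (induction T' rule: dec_induct)
    case (step n)
    then have "S t k \<subseteq> S n k" by simp
    also have "S n k \<subseteq> S (Suc n) k"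
      using mono1 [of "Suc n" k] step that by simp
    finally show ?case .
  qed auto
  have memT: "\<pi> t k \<in> S T k" if "t \<in> {1..T}" "k \<in> {1..D}" for t k
    using mem [OF that] mono [of k t T] that by auto
  have born: "s \<in> {1..t}" if "k \<in> {1..D}" "t \<le> T" "s \<in> S t k" for s t k
    using that(2,3)
  proof (induction t)
    case 0
    then show ?case using run that(1) by (auto simp: propagate_run_def)
  next
    case (Suc t)
    then have "s = Suc t \<or> s \<in> S t k" using new [of "Suc t" k] that(1) by auto
    then show ?case using Suc by auto
  qed
  have edge: "(u, v) \<in> ?R \<longleftrightarrow> (\<exists>k s. k \<in> {1..D} \<and> s \<in> S T k \<and> v = Node k s \<and>
      u = (if k = 1 then Root else Node (k - 1) (\<pi> s (k - 1))))" for u v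
    by (auto simp: tree_edges_def)
  have RV: "?R \<subseteq> ?V \<times> ?V"
  proof (clarify, intro conjI SigmaI)
    fix u v assume "(u, v) \<in> ?R"
    then obtain k s where ks: "k \<in> {1..D}" "s \<in> S T k" "v = Node k s"
        "u = (if k = 1 then Root else Node (k - 1) (\<pi> s (k - 1)))"
      unfolding edge by blast
    then show "v \<in> ?V" by (auto simp: tree_nodes_def)
    show "u \<in> ?V"
    proof (cases "k = 1")
      case True
      then show ?thesis using ks(4) by (simp add: tree_nodes_def)
    next
      case False
      then have k: "k - 1 \<in> {1..D}" using ks(1) by auto
      have "\<pi> s (k - 1) \<in> S T (k - 1)"
        using memT [OF born [OF ks(1) order_refl ks(2)] k] .
      then show ?thesis using ks(4) k False unfolding tree_nodes_def by simp
    qed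
  qed
  have root: "Root \<in> ?V" by (simp add: tree_nodes_def)
  have no_root: "(u, Root) \<notin> ?R" for u by (simp add: edge)
  have single: "\<And>u u' v. (u, v) \<in> ?R \<Longrightarrow> (u', v) \<in> ?R \<Longrightarrow> u = u'"
    unfolding edge by fastforce
  have invs: "Root \<in> E \<and> E \<subseteq> ?V \<and> (\<forall>u v. (u, v) \<in> ?R \<longrightarrow> v \<in> E \<longrightarrow> u \<in> E) \<and>
      (\<forall>u v v'. (u, v) \<in> ?R \<longrightarrow> (u, v') \<in> ?R \<longrightarrow> v \<in> E \<longrightarrow> v' \<in> E)"
    by (rule pruning_invariants [OF E(1) RV root no_root]) (rule single)
  have inv: "Root \<in> E" "E \<subseteq> ?V"
      "\<And>u v. (u, v) \<in> ?R \<Longrightarrow> v \<in> E \<Longrightarrow> u \<in> E"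
      "\<And>u v v'. (u, v) \<in> ?R \<Longrightarrow> (u, v') \<in> ?R \<Longrightarrow> v \<in> E \<Longrightarrow> v' \<in> E"
    using invs by blast+
  have climb: "\<exists>s'. Node 1 s' \<in> E" if "Node k s \<in> E" for k s
    using that
  proof (induction k arbitrary: s)
    case 0
    then show ?case using inv(2) by (auto simp: tree_nodes_def)
  next
    case (Suc k)
    show ?case
    proof (cases "k = 0")
      case True
      then show ?thesis using Suc.prems by auto
    next
      case False
      have "(Node k (\<pi> s k), Node (Suc k) s) \<in> ?R"
        using subsetD [OF inv(2) Suc.prems] False unfolding edge by (simp add: tree_nodes_def)
      then show ?thesis using Suc inv(3) by blast
    qed
  qed
  obtain v where v: "v \<in> E" "v \<noteq> Root" using E(2) inv(1) by blast
  then obtain s1 where s1: "Node 1 s1 \<in> E" using climb by (cases v) auto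
  show ?thesis
    unfolding rounds_have_leaf_def
  proof (intro ballI)
    fix t assume t: "t \<in> {1..T}"
    let ?p = "\<lambda>k. Node k (\<pi> t k)"
    have p1: "?p 1 \<in> E"
    proof -
      have "(Root, Node 1 s1) \<in> ?R" "(Root, ?p 1) \<in> ?R"
        using s1 inv(2) memT [OF t] D by (auto simp: edge tree_nodes_def)
      then show ?thesis using inv(4) s1 by blast
    qed
    define m where "m = Max {k \<in> {1..D}. ?p k \<in> E}"
    have m: "m \<in> {k \<in> {1..D}. ?p k \<in> E}"
      unfolding m_def using p1 D by (intro Max_in) auto
    have m_max: "k \<le> m" if "k \<in> {1..D}" "?p k \<in> E" for k
      unfolding m_def using that by (intro Max_ge) auto
    have leaf: "?p m \<in> leaves ?R E"
    proof (cases "m < D")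
      case True
      then have "(?p m, ?p (Suc m)) \<in> ?R" using paths [OF t] m by auto
      moreover have "?p (Suc m) \<notin> E" using m_max [of "Suc m"] True by auto
      ultimately show ?thesis using inv(4) m by (auto simp: leaves_def)
    next
      case False
      then have "(?p m, u) \<notin> ?R" for u using m by (auto simp: edge)
      then show ?thesis using m by (auto simp: leaves_def)
    qed
    have below: "k \<le> m \<Longrightarrow> 1 \<le> k \<Longrightarrow> ?p k \<in> E" for k
    proof (induction k rule: inc_induct)
      case base
      then show ?case using m by auto
    next
      case (step k)
      then show ?case using paths [OF t, of k] m inv(3) by auto
    qed
    have uniq: "k = m" if k: "k \<in> {1..D}" "?p k \<in> leaves ?R E" for k
    proof (rule ccontr)
      assume "k \<noteq> m"
      moreover have "k \<le> m" using k m_max by (auto simp: leaves_def)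
      ultimately have "k < m" by simp
      then have "?p (Suc k) \<in> E" "(?p k, ?p (Suc k)) \<in> ?R"
        using below [of "Suc k"] paths [OF t, of k] k m by auto
      then show False using k by (auto simp: leaves_def)
    qed
    show "\<exists>!v. v \<in> leaves ?R E \<and> v \<in> active_nodes D \<pi> t"
    proof (rule ex1I [of _ "?p m"])
      show "?p m \<in> leaves ?R E \<and> ?p m \<in> active_nodes D \<pi> t"
        using leaf m unfolding active_nodes_def by blast
      show "v = ?p m" if v: "v \<in> leaves ?R E \<and> v \<in> active_nodes D \<pi> t" for v
      proof -
        obtain k where "k \<in> {1..D}" "v = ?p k"
          using v unfolding active_nodes_def by blast
        with uniq v show ?thesis by metis
      qed
    qed
  qed
qed

section \<open>Admissible functions\<close>

definition admissible ::
  "('a::real_vector \<Rightarrow> real) \<Rightarrow> (nat \<Rightarrow> nat \<Rightarrow> real) \<Rightarrow> (nat \<Rightarrow> real) \<Rightarrow> nat \<Rightarrow> nat \<Rightarrow>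
   (nat \<Rightarrow> 'a) \<Rightarrow> (node \<times> node) set \<Rightarrow> node set \<Rightarrow> ('a \<Rightarrow> real) set" where
  "admissible N \<rho> L D T x R E =
     {f. f ` norm_ball N 0 1 \<subseteq> {0..1} \<and>
         (\<forall>k\<in>{1..D}. \<forall>t\<in>{1..T}. \<forall>i\<in>leaves_at R E k.
            \<forall>z \<in> norm_ball N (x i) (\<rho> k t) \<inter> norm_ball N 0 1.
              \<bar>f (x i) - f z\<bar> \<le> L k * \<rho> k t)}"

end

theory Submission
  imports Defs
begin

text \<open>
  The learners of level 1 already suffice. The level-1 centers form a \<open>\<rho> 1 T\<close>-packing of the unit
  ball, so there are \<open>O((L 1 * T) powr (d / (d + 1)))\<close> of them. Exp-concavity of the square loss
  bounds the regret of the aggregation against the active level-1 nodes by their number times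
  \<open>2 * ln (D * T)\<close>, and Follow-the-Leader has logarithmic regret at each of them against the constant
  \<open>f\<close>-value at its center. Since \<open>f\<close> is almost Lipschitz around every leaf center of \<open>E\<close>, passing from
  the level-1 center to \<open>x t\<close> through the leaf of round \<open>t\<close> costs a multiple of \<open>\<rho> 1 t\<close>, and these
  radii sum to \<open>O(T powr (d / (d + 1)) * ln T)\<close>. The resulting constant depends on \<open>L\<close>; as \<open>T0\<close> may
  depend on \<open>L\<close> too, one more factor \<open>ln T\<close> absorbs it, and the expectation is at least
  \<open>L 1 powr (d / (d + 1))\<close>.
\<close>

section \<open>Packings in an arbitrary norm\<close>

lemma norm_uminus:
  assumes "is_norm N"
  shows "N (- z) = N z"
proof -
  have "N ((-1) *\<^sub>R z) = \<bar>-1\<bar> * N z"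
    using assms unfolding is_norm_def by blast
  then show ?thesis by simp
qed

lemma norm_minus_commute':
  assumes "is_norm N"
  shows "N (a - b) = N (b - a)"
  using norm_uminus [OF assms, of "a - b"] by simp

lemma norm_triangle_sub:
  assumes "is_norm N"
  shows "N (a - c) \<le> N (a - b) + N (b - c)"
proof -
  have "N ((a - b) + (b - c)) \<le> N (a - b) + N (b - c)"
    using assms unfolding is_norm_def by blast
  then show ?thesis by simp
qed

lemma norm_le_coordinates:
  fixes z :: "'a::euclidean_space"
  assumes N: "is_norm N"
  shows "N z \<le> (\<Sum>b\<in>Basis. \<bar>z \<bullet> b\<bar> * N b)"
proof -
  have "N (\<Sum>b\<in>B. (z \<bullet> b) *\<^sub>R b) \<le> (\<Sum>b\<in>B. \<bar>z \<bullet> b\<bar> * N b)" if "finite B" for B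
    using that
  proof induction
    case empty
    have "N 0 = 0" using N unfolding is_norm_def by blast
    then show ?case by simp
  next
    case (insert b B)
    have "N ((z \<bullet> b) *\<^sub>R b + (\<Sum>b\<in>B. (z \<bullet> b) *\<^sub>R b))
        \<le> N ((z \<bullet> b) *\<^sub>R b) + N (\<Sum>b\<in>B. (z \<bullet> b) *\<^sub>R b)"
      using N unfolding is_norm_def by blast
    also have "N ((z \<bullet> b) *\<^sub>R b) = \<bar>z \<bullet> b\<bar> * N b"
      using N unfolding is_norm_def by blast
    finally show ?case using insert by simp
  qed
  from this [of Basis] show ?thesis by (simp add: euclidean_representation)
qed

text \<open>Half of the equivalence of norms in finite dimension: \<open>N\<close> is Lipschitz by
  \<open>norm_le_coordinates\<close>, hence continuous, and attains on the compact Euclidean unit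
  sphere a minimum, which is positive. Homogeneity extends the bound to every vector.\<close>

lemma norm_lower_bound:
  fixes N :: "'a::euclidean_space \<Rightarrow> real"
  assumes N: "is_norm N"
  obtains m where "0 < m" "\<And>z. m * norm z \<le> N z"
proof -
  define M where "M = (\<Sum>b\<in>Basis. N (b :: 'a))"
  have nonneg: "0 \<le> N z" for z using N by (simp add: is_norm_def)
  have upper: "N z \<le> M * norm z" for z
  proof -
    have "N z \<le> (\<Sum>b\<in>Basis. \<bar>z \<bullet> b\<bar> * N b)" by (rule norm_le_coordinates [OF N])
    also have "\<dots> \<le> (\<Sum>b\<in>Basis. norm z * N b)"
      by (intro sum_mono mult_right_mono nonneg Basis_le_norm)
    finally show ?thesis by (simp add: M_def sum_distrib_left mult.commute)
  qed
  have diff: "\<bar>N z - N w\<bar> \<le> M * norm (z - w)" for z w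
    using norm_triangle_sub [OF N, of z 0 w] norm_triangle_sub [OF N, of w 0 z]
      upper [of "z - w"] norm_minus_commute' [OF N, of z w] by (simp add: abs_le_iff)
  have "continuous_on (sphere 0 1) N"
  proof (rule continuous_onI)
    fix w :: 'a and e :: real assume e: "0 < e"
    have M: "0 \<le> M" unfolding M_def by (intro sum_nonneg nonneg)
    \<comment> \<open>The denominator \<open>M + 1\<close> keeps the radius well defined when only
      \<open>0 \<le> M\<close> is known.\<close>
    have "dist (N z) (N w) \<le> e" if "dist z w < e / (M + 1)" for z
    proof -
      have "M * norm (z - w) \<le> (M + 1) * (e / (M + 1))"
        using that M e by (intro mult_mono) (auto simp: dist_norm)
      then show ?thesis using diff [of z w] M by (simp add: dist_real_def)
    qed
    then show "\<exists>d>0. \<forall>z\<in>sphere 0 1. dist z w < d \<longrightarrow> dist (N z) (N w) \<le> e"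
      using M e by (intro exI [of _ "e / (M + 1)"]) auto
  qed
  then obtain u where u: "u \<in> sphere 0 1" "\<And>z. z \<in> sphere 0 1 \<Longrightarrow> N u \<le> N z"
    using continuous_attains_inf [of "sphere (0::'a) 1" N] by (auto simp: compact_sphere)
  have "u \<noteq> 0" using u(1) by auto
  then have "0 < N u" using N nonneg [of u] by (auto simp: is_norm_def order_less_le)
  moreover have "N u * norm z \<le> N z" for z
  proof (cases "z = 0")
    case True
    then show ?thesis using nonneg by simp
  next
    case False
    have "N u \<le> N ((1 / norm z) *\<^sub>R z)" using False by (intro u(2)) simp
    also have "\<dots> = \<bar>1 / norm z\<bar> * N z"
      using N unfolding is_norm_def by blast
    finally show ?thesis using False by (simp add: field_simps)
  qed
  ultimately show ?thesis by (rule that)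
qed

text \<open>Grid cells of side \<open>r / (\<Sum>b\<in>Basis. N b)\<close> contain at most one point of the packing.\<close>

lemma packing_bound:
  fixes N :: "'a::euclidean_space \<Rightarrow> real"
  assumes N: "is_norm N"
  obtains G where "0 < G"
    "\<And>r (x :: 'i \<Rightarrow> 'a) C. \<lbrakk>0 < r; r \<le> 1; \<And>i. i \<in> C \<Longrightarrow> N (x i) \<le> 1;
       \<And>i j. \<lbrakk>i \<in> C; j \<in> C; i \<noteq> j\<rbrakk> \<Longrightarrow> r < N (x i - x j)\<rbrakk>
       \<Longrightarrow> real (card C) \<le> (G / r) ^ DIM('a)"
proof -
  obtain m where m: "0 < m" "\<And>z. m * norm z \<le> N z"
    using norm_lower_bound [OF N] by blast
  define M where "M = (\<Sum>b\<in>Basis. N (b :: 'a))"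
  have nonneg: "0 \<le> N z" for z using N by (simp add: is_norm_def)
  have "0 < M"
    unfolding M_def
  proof (rule sum_pos)
    show "0 < N b" if "b \<in> Basis" for b
      using N nonneg [of b] nonzero_Basis [OF that] by (auto simp: is_norm_def order_less_le)
  qed auto
  \<comment> \<open>Each coordinate meets \<open>2 * n + 1\<close> cells with \<open>n\<close> at
    most \<open>(M / m) / r + 1\<close>; the resulting \<open>2 * (M / m) / r + 3\<close> is at most
    \<open>G / r\<close> because \<open>3 \<le> 3 / r\<close> for \<open>r \<le> 1\<close>.\<close>
  define G where "G = 2 * M / m + 3"
  have G: "0 < G" using m(1) \<open>0 < M\<close> by (simp add: G_def add_pos_pos)
  have bound: "real (card C) \<le> (G / r) ^ DIM('a)"
    if r: "0 < r" "r \<le> 1" and C: "\<And>i. i \<in> C \<Longrightarrow> N (x i) \<le> 1"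
      and sep: "\<And>i j. \<lbrakk>i \<in> C; j \<in> C; i \<noteq> j\<rbrakk> \<Longrightarrow> r < N (x i - x j)"
    for r and x :: "'i \<Rightarrow> 'a" and C
  proof -
    define h where "h = r / M"
    have h: "0 < h" using r \<open>0 < M\<close> by (simp add: h_def)
    \<comment> \<open>Points of the unit ball of \<open>N\<close> have Euclidean norm at most
      \<open>1 / m\<close>, so \<open>n\<close> bounds all cell indices in absolute value.\<close>
    define n where "n = \<lceil>1 / m / h\<rceil>"
    define cell where "cell i = (\<lambda>b\<in>Basis. \<lfloor>(x i \<bullet> b) / h\<rfloor>)" for i
    have n0: "0 \<le> n" using m(1) h unfolding n_def by (simp add: order_less_le_trans [of "-1" 0])
    have "inj_on cell C"
    proof (rule inj_onI, rule ccontr)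
      fix i j assume ij: "i \<in> C" "j \<in> C" "cell i = cell j" "i \<noteq> j"
      have "\<bar>(x i - x j) \<bullet> b\<bar> \<le> h" if "b \<in> Basis" for b
      proof -
        have "\<lfloor>(x i \<bullet> b) / h\<rfloor> = \<lfloor>(x j \<bullet> b) / h\<rfloor>"
          using fun_cong [OF ij(3), of b] that by (simp add: cell_def)
        then have "\<bar>(x i \<bullet> b) / h - (x j \<bullet> b) / h\<bar> \<le> 1" by linarith
        then have "\<bar>((x i - x j) \<bullet> b) / h\<bar> \<le> 1" by (simp add: inner_diff_left diff_divide_distrib)
        then show ?thesis using h by simp
      qed
      then have "N (x i - x j) \<le> (\<Sum>b\<in>Basis. h * N b)"
        by (intro order_trans [OF norm_le_coordinates [OF N]] sum_mono mult_right_mono nonneg)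
      also have "\<dots> = h * M" by (simp add: M_def sum_distrib_left)
      also have "\<dots> = r" using \<open>0 < M\<close> by (simp add: h_def)
      finally show False using sep [OF ij(1,2,4)] by simp
    qed
    moreover have "cell ` C \<subseteq> (\<Pi>\<^sub>E b\<in>Basis. {-n..n})"
    proof (clarify, intro PiE_I)
      fix i and b :: 'a assume "i \<in> C" "b \<in> Basis"
      have "m * norm (x i) \<le> 1" using m(2) [of "x i"] C [OF \<open>i \<in> C\<close>] by simp
      then have "norm (x i) \<le> 1 / m" using m(1) by (simp add: field_simps)
      then have "\<bar>x i \<bullet> b\<bar> \<le> 1 / m" using Basis_le_norm [OF \<open>b \<in> Basis\<close>, of "x i"] by simp
      then have "\<bar>(x i \<bullet> b) / h\<bar> \<le> 1 / m / h"
        using h by (simp add: divide_right_mono del: divide_divide_eq_left)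
      then have "- n \<le> \<lfloor>(x i \<bullet> b) / h\<rfloor>" "\<lfloor>(x i \<bullet> b) / h\<rfloor> \<le> n"
        unfolding n_def by linarith+
      then show "cell i b \<in> {-n..n}" using \<open>b \<in> Basis\<close> by (simp add: cell_def)
    qed (auto simp: cell_def)
    ultimately have "card C \<le> card (\<Pi>\<^sub>E b\<in>(Basis::'a set). {-n..n})"
      by (intro card_inj_on_le finite_PiE) auto
    also have "\<dots> = nat (2 * n + 1) ^ DIM('a)" by (simp add: card_PiE)
    finally have "real (card C) \<le> real (nat (2 * n + 1) ^ DIM('a))" by (rule of_nat_mono)
    also have "\<dots> = (2 * real_of_int n + 1) ^ DIM('a)" using n0 by simp
    also have "\<dots> \<le> (G / r) ^ DIM('a)"
    proof (rule power_mono)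
      have "real_of_int n \<le> 1 / m / h + 1" unfolding n_def by linarith
      also have "1 / m / h = (M / m) / r" by (simp add: h_def)
      finally have "2 * real_of_int n + 1 \<le> 2 * (M / m) / r + 3" by simp
      also have "3 \<le> 3 / r" using r by (simp add: field_simps)
      finally show "2 * real_of_int n + 1 \<le> G / r" by (simp add: G_def add_divide_distrib)
    qed (use n0 in simp)
    finally show ?thesis .
  qed
  show ?thesis by (rule that [OF G bound])
qed

section \<open>Hedge and Follow-the-Leader for the square loss\<close>

text \<open>The sequence \<open>harm n - ln n\<close> decreases from its value 1 at
  \<open>n = 1\<close>.\<close>

lemma harm_le_ln: "1 \<le> n \<Longrightarrow> harm n \<le> 1 + ln (real n)"
  using decseqD [OF decseq_harm_diff_ln, of 0 "n - 1"] by (simp add: harm_def)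

text \<open>This is what makes the rate 1/2 of the weight update admissible: the second derivative
  is \<open>(y - z)^2 / 4 - 1 / 2\<close> times a positive factor, hence nonpositive when
  \<open>\<bar>y - z\<bar> \<le> 1\<close>.\<close>

lemma square_exp_concave:
  fixes y :: real
  assumes y: "y \<in> {0..1}"
  shows "concave_on {0..1} (\<lambda>z. exp (- (1/2) * ((y - z)\<^sup>2 / 2)))"
proof (rule f''_le0_imp_concave)
  let ?g = "\<lambda>z. exp (- (1/2) * ((y - z)\<^sup>2 / 2))"
  show "convex {0..1::real}" by (rule convex_real_interval)
  show deriv: "(?g has_real_derivative (y - z) / 2 * ?g z) (at z)" for z
    by (rule derivative_eq_intros refl | simp)+ (simp add: field_simps)
  show "((\<lambda>z. (y - z) / 2 * ?g z) has_real_derivative ((y - z)\<^sup>2 / 4 - 1 / 2) * ?g z) (at z)" for z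
    by (rule derivative_eq_intros deriv refl | simp)+ (simp add: power2_eq_square algebra_simps)
  show "((y - z)\<^sup>2 / 4 - 1 / 2) * ?g z \<le> 0" if z: "z \<in> {0..1}" for z
  proof -
    have "\<bar>y - z\<bar> \<le> 1" using y z by auto
    then have "(y - z)\<^sup>2 \<le> 1" by (simp add: abs_square_le_1)
    then show ?thesis by (intro mult_nonpos_nonneg) auto
  qed
qed

text \<open>The difference factors as \<open>b - a\<close> times a number in \<open>[-1, 1]\<close>;
  this converts deviations of \<open>f\<close>-values into regret.\<close>

lemma square_loss_diff_le:
  assumes "y t \<in> {0..1}" "a \<in> {0..1}" "b \<in> {0..1}"
  shows "square_loss y t a - square_loss y t b \<le> \<bar>a - b\<bar>"
proof -
  have "square_loss y t a - square_loss y t b = (b - a) * ((2 * y t - a - b) / 2)"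
    by (simp add: square_loss_def power2_eq_square field_simps)
  also have "\<dots> \<le> \<bar>(b - a) * ((2 * y t - a - b) / 2)\<bar>" by simp
  also have "\<dots> = \<bar>b - a\<bar> * \<bar>(2 * y t - a - b) / 2\<bar>" by (rule abs_mult)
  also have "\<dots> \<le> \<bar>b - a\<bar> * 1" using assms by (intro mult_left_mono) (auto simp: abs_le_iff)
  finally show ?thesis by (simp add: abs_minus_commute)
qed

section \<open>Total mass of the weights and regret of the aggregation\<close>

lemma hedge_weight_pos:
  assumes "\<And>t. finite (A t)"
  shows "0 < hedge_weight \<l> A p t v"
proof (induction t arbitrary: v)
  case (Suc t)
  show ?case
  proof (cases "v \<in> A (Suc t)")
    case True
    then have "0 < (\<Sum>u\<in>A (Suc t). hedge_weight \<l> A p t u)"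
      "0 < (\<Sum>u\<in>A (Suc t). hedge_weight \<l> A p t u * exp (- (1/2) * \<l> (Suc t) (p (Suc t) u)))"
      using assms [of "Suc t"] Suc by (auto intro!: sum_pos)
    then show ?thesis using Suc True by (simp add: Let_def)
  qed (use Suc in simp)
qed simp

text \<open>The normalizer \<open>Z\<close> is the weighted average of the exponential factors, so
  dividing by it restores the total weight of the active nodes.\<close>

lemma hedge_weight_active_sum:
  assumes fin: "\<And>t. finite (A t)"
  shows "(\<Sum>u\<in>A (Suc t). hedge_weight \<l> A p (Suc t) u) = (\<Sum>u\<in>A (Suc t). hedge_weight \<l> A p t u)"
proof (cases "A (Suc t) = {}")
  case False
  let ?w = "hedge_weight \<l> A p t"
  let ?e = "\<lambda>u. exp (- (1/2) * \<l> (Suc t) (p (Suc t) u))"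
  have pos: "0 < (\<Sum>u\<in>A (Suc t). ?w u)" "0 < (\<Sum>u\<in>A (Suc t). ?w u * ?e u)"
    using fin [of "Suc t"] False hedge_weight_pos [OF fin] by (auto intro!: sum_pos)
  have "(\<Sum>u\<in>A (Suc t). hedge_weight \<l> A p (Suc t) u)
      = (\<Sum>u\<in>A (Suc t). ?w u * ?e u / (1 / (\<Sum>u\<in>A (Suc t). ?w u) * (\<Sum>u\<in>A (Suc t). ?w u * ?e u)))"
    by (intro sum.cong) (simp_all add: Let_def)
  also have "\<dots> = (\<Sum>u\<in>A (Suc t). ?w u)"
    using pos by (subst sum_divide_distrib [symmetric]) simp
  finally show ?thesis .
qed simp

text \<open>Active mass is preserved and inactive weights are frozen, so the initial mass, 1 per
  node of \<open>U\<close>, persists. It caps every single weight in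
  \<open>hedge_regret\<close>.\<close>

lemma hedge_weight_sum:
  assumes fin: "\<And>t. finite (A t)" and U: "finite U" "\<And>t. t \<in> {1..T} \<Longrightarrow> A t \<subseteq> U"
  shows "(\<Sum>u\<in>U. hedge_weight \<l> A p T u) = real (card U)"
  using U(2)
proof (induction T)
  case (Suc T)
  have sub: "A (Suc T) \<subseteq> U" using Suc.prems by simp
  have "(\<Sum>u\<in>U. hedge_weight \<l> A p (Suc T) u)
      = (\<Sum>u\<in>U - A (Suc T). hedge_weight \<l> A p (Suc T) u) + (\<Sum>u\<in>A (Suc T). hedge_weight \<l> A p (Suc T) u)"
    by (rule sum.subset_diff [OF sub U(1)])
  also have "(\<Sum>u\<in>U - A (Suc T). hedge_weight \<l> A p (Suc T) u)
      = (\<Sum>u\<in>U - A (Suc T). hedge_weight \<l> A p T u)"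
    by (intro sum.cong) (simp_all add: Let_def)
  also have "\<dots> + (\<Sum>u\<in>A (Suc T). hedge_weight \<l> A p (Suc T) u) = (\<Sum>u\<in>U. hedge_weight \<l> A p T u)"
    by (subst hedge_weight_active_sum [OF fin]) (rule sum.subset_diff [OF sub U(1), symmetric])
  also have "\<dots> = real (card U)" using Suc by simp
  finally show ?case .
qed simp

text \<open>By Jensen's inequality for the concave exponential, \<open>Z\<close> is at most
  \<open>exp (- l / 2)\<close> with \<open>l\<close> the loss of the aggregate. Hence the log-weight
  of \<open>v\<close> gains at least half the excess of \<open>l\<close> over the loss of
  \<open>v\<close>.\<close>

lemma hedge_step_regret:
  assumes fin: "\<And>t. finite (A t)" and v: "v \<in> A (Suc t)"
    and y: "y (Suc t) \<in> {0..1}" and p: "\<And>u. u \<in> A (Suc t) \<Longrightarrow> p (Suc t) u \<in> {0..1}"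
  shows "square_loss y (Suc t) (hedge_prediction (square_loss y) A p (Suc t)) -
      square_loss y (Suc t) (p (Suc t) v)
    \<le> 2 * (ln (hedge_weight (square_loss y) A p (Suc t) v) - ln (hedge_weight (square_loss y) A p t v))"
proof -
  let ?w = "hedge_weight (square_loss y) A p t"
  let ?W = "\<Sum>u\<in>A (Suc t). ?w u"
  let ?g = "\<lambda>z. exp (- (1/2) * square_loss y (Suc t) z)"
  let ?Z = "(1 / ?W) * (\<Sum>u\<in>A (Suc t). ?w u * ?g (p (Suc t) u))"
  have w: "0 < ?w u" for u using hedge_weight_pos [OF fin] .
  have W: "0 < ?W" and "0 < (\<Sum>u\<in>A (Suc t). ?w u * ?g (p (Suc t) u))"
    using fin [of "Suc t"] v w by (auto intro!: sum_pos)
  then have Z: "0 < ?Z" by simp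
  have "(\<Sum>u\<in>A (Suc t). (?w u / ?W) * ?g (p (Suc t) u)) \<le> ?g (\<Sum>u\<in>A (Suc t). (?w u / ?W) *\<^sub>R p (Suc t) u)"
  proof (rule concave_on_sum [OF fin])
    show "A (Suc t) \<noteq> {}" using v by auto
    show "concave_on {0..1} ?g" unfolding square_loss_def by (rule square_exp_concave [OF y])
    show "(\<Sum>u\<in>A (Suc t). ?w u / ?W) = 1" using W by (simp flip: sum_divide_distrib)
  qed (use w W p in \<open>auto simp: less_imp_le\<close>)
  then have "?Z \<le> ?g (hedge_prediction (square_loss y) A p (Suc t))"
    by (simp add: hedge_prediction_def sum_distrib_left)
  then have "ln ?Z \<le> ln (?g (hedge_prediction (square_loss y) A p (Suc t)))"
    using Z by (subst ln_le_cancel_iff) auto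
  moreover have "ln (hedge_weight (square_loss y) A p (Suc t) v) =
      ln (?w v * ?g (p (Suc t) v) / ?Z)"
    using v by (simp add: Let_def)
  moreover have "\<dots> = ln (?w v) - 1/2 * square_loss y (Suc t) (p (Suc t) v) - ln ?Z"
    using w [of v] Z by (subst ln_div; (subst ln_mult_pos)?) auto
  ultimately show ?thesis by simp
qed

text \<open>Rounds in which \<open>v\<close> is inactive leave its weight unchanged, so the logarithmic weight
  increments telescope for each \<open>v\<close> separately.\<close>

lemma hedge_regret:
  assumes fin: "\<And>t. finite (A t)"
    and y: "\<And>t. t \<in> {1..T} \<Longrightarrow> y t \<in> {0..1}"
    and p: "\<And>t u. t \<in> {1..T} \<Longrightarrow> u \<in> A t \<Longrightarrow> p t u \<in> {0..1}"
    and P: "finite P" "\<And>t. t \<in> {1..T} \<Longrightarrow> A t \<inter> P = {c t}"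
    and U: "finite U" "P \<subseteq> U" "\<And>t. t \<in> {1..T} \<Longrightarrow> A t \<subseteq> U"
  shows "(\<Sum>t=1..T. square_loss y t (hedge_prediction (square_loss y) A p t) - square_loss y t (p t (c t)))
    \<le> 2 * real (card P) * ln (real (card U))"
proof -
  let ?w = "hedge_weight (square_loss y) A p"
  have "(\<Sum>t=1..T'. square_loss y t (hedge_prediction (square_loss y) A p t) - square_loss y t (p t (c t)))
      \<le> 2 * (\<Sum>v\<in>P. ln (?w T' v))" if "T' \<le> T" for T'
    using that
  proof (induction T')
    case (Suc n)
    have n: "Suc n \<in> {1..T}" using Suc.prems by simp
    have c: "c (Suc n) \<in> A (Suc n)" "c (Suc n) \<in> P" using P(2) [OF n] by auto
    have "?w (Suc n) v = ?w n v" if "v \<in> P - {c (Suc n)}" for v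
    proof -
      have "v \<notin> A (Suc n)" using that P(2) [OF n] by blast
      then show ?thesis by (simp add: Let_def)
    qed
    then have eq: "(\<Sum>v\<in>P - {c (Suc n)}. ln (?w (Suc n) v)) = (\<Sum>v\<in>P - {c (Suc n)}. ln (?w n v))"
      by (intro sum.cong refl) (rule arg_cong)
    have "square_loss y (Suc n) (hedge_prediction (square_loss y) A p (Suc n)) -
        square_loss y (Suc n) (p (Suc n) (c (Suc n)))
      \<le> 2 * (ln (?w (Suc n) (c (Suc n))) - ln (?w n (c (Suc n))))"
      using c(1) y [OF n] p [OF n] by (intro hedge_step_regret [OF fin])
    also have "\<dots> = 2 * (\<Sum>v\<in>P. ln (?w (Suc n) v)) - 2 * (\<Sum>v\<in>P. ln (?w n v))"
      unfolding sum.remove [OF P(1) c(2)] eq by simp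
    finally show ?case using Suc by simp
  qed simp
  then have "(\<Sum>t=1..T. square_loss y t (hedge_prediction (square_loss y) A p t) - square_loss y t (p t (c t)))
      \<le> 2 * (\<Sum>v\<in>P. ln (?w T v))" by simp
  \<comment> \<open>Positive weights with sum \<open>card U\<close> are each at most
    \<open>card U\<close>.\<close>
  also have "\<dots> \<le> 2 * (\<Sum>v\<in>P. ln (real (card U)))"
  proof (intro mult_left_mono sum_mono)
    fix v assume v: "v \<in> P"
    have "?w T v \<le> (\<Sum>u\<in>U. ?w T u)"
      using v U hedge_weight_pos [OF fin] by (intro member_le_sum) (auto simp: less_imp_le)
    also have "\<dots> = real (card U)" by (rule hedge_weight_sum [OF fin U(1) U(3)])
    finally have "?w T v \<le> real (card U)" .
    moreover have "0 < ?w T v" using hedge_weight_pos [OF fin] .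
    ultimately show "ln (?w T v) \<le> ln (real (card U))" by (subst ln_le_cancel_iff) auto
  qed auto
  finally show ?thesis by simp
qed

section \<open>Follow-the-Leader at a single node\<close>

lemma sum_squares_about_mean:
  fixes y :: "'i \<Rightarrow> real"
  assumes "finite J" "J \<noteq> {}"
  shows "(\<Sum>s\<in>J. (y s - z)\<^sup>2 / 2) =
    (\<Sum>s\<in>J. (y s - sum y J / card J)\<^sup>2 / 2) + card J / 2 * (z - sum y J / card J)\<^sup>2"
proof -
  let ?m = "sum y J / card J"
  have "(\<Sum>s\<in>J. (y s - z)\<^sup>2 / 2) =
      (\<Sum>s\<in>J. (y s - ?m)\<^sup>2 / 2 + (?m - z) * (y s - ?m) + (z - ?m)\<^sup>2 / 2)"
  proof (rule sum.cong)
    show "(y s - z)\<^sup>2 / 2 = (y s - m)\<^sup>2 / 2 + (m - z) * (y s - m) + (z - m)\<^sup>2 / 2" for s m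
      by (simp add: power2_eq_square field_simps)
  qed simp
  also have "\<dots> = (\<Sum>s\<in>J. (y s - ?m)\<^sup>2 / 2) + (?m - z) * (\<Sum>s\<in>J. y s - ?m) + card J * ((z - ?m)\<^sup>2 / 2)"
    by (simp add: sum.distrib sum_distrib_left)
  \<comment> \<open>Deviations from the mean cancel, which removes the cross term.\<close>
  also have "(\<Sum>s\<in>J. y s - ?m) = 0" using assms by (simp add: sum_subtractf)
  finally show ?thesis by simp
qed

text \<open>Data in \<open>[0, 1]\<close> have their mean in \<open>[0, 1]\<close>, so the
  constrained minimizer is the mean and the exact quadratic expansion around it applies.\<close>

lemma leader_strong_convexity:
  assumes J: "finite J" and y: "\<And>s. s \<in> J \<Longrightarrow> y s \<in> {0..1}"
    and m: "is_arg_min (\<lambda>z. \<Sum>s\<in>J. square_loss y s z) (\<lambda>z. z \<in> {0..1}) m"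
  shows "(\<Sum>s\<in>J. square_loss y s z) = (\<Sum>s\<in>J. square_loss y s m) + card J / 2 * (z - m)\<^sup>2"
proof (cases "J = {}")
  case False
  let ?a = "sum y J / card J"
  have card: "0 < real (card J)" using J False by (simp add: card_gt_0_iff)
  have "sum y J \<le> (\<Sum>s\<in>J. 1)" using y by (intro sum_mono) auto
  moreover have "0 \<le> sum y J" using y by (intro sum_nonneg) auto
  ultimately have a: "?a \<in> {0..1}" using card by auto
  have expand: "(\<Sum>s\<in>J. square_loss y s z) = (\<Sum>s\<in>J. square_loss y s ?a) + card J / 2 * (z - ?a)\<^sup>2" for z
    unfolding square_loss_def by (rule sum_squares_about_mean [OF J False])
  have "(\<Sum>s\<in>J. square_loss y s m) \<le> (\<Sum>s\<in>J. square_loss y s ?a)"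
    using m a by (auto simp: is_arg_min_def not_less)
  then have "card J / 2 * (m - ?a)\<^sup>2 \<le> 0" using expand [of m] by simp
  then have "m = ?a" using card by (simp add: mult_le_0_iff)
  then show ?thesis using expand by metis
qed simp

text \<open>Induction on rounds with the comparator left arbitrary: the hypothesis is used at the
  current leader \<open>m\<close>, and \<open>leader_strong_convexity\<close> then trades
  \<open>m\<close> for \<open>c\<close>. The gain \<open>card J / 2 * (c - m)^2\<close> pays for all
  but \<open>1 / k\<close> of the loss gap in the new round, and these remainders form the harmonic
  sum.\<close>

lemma follow_the_leader_regret:
  assumes y: "\<And>t. t \<in> {1..T} \<Longrightarrow> y t \<in> {0..1}" and ftl: "follow_the_leader (square_loss y) A T p"
    and c: "c \<in> {0..1}"
  shows "(\<Sum>t\<in>{t\<in>{1..T}. v \<in> A t}. square_loss y t (p t v))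
    \<le> (\<Sum>t\<in>{t\<in>{1..T}. v \<in> A t}. square_loss y t c) + harm (card {t\<in>{1..T}. v \<in> A t})"
proof -
  have "(\<Sum>t\<in>{t\<in>{1..n}. v \<in> A t}. square_loss y t (p t v))
    \<le> (\<Sum>t\<in>{t\<in>{1..n}. v \<in> A t}. square_loss y t c) + harm (card {t\<in>{1..n}. v \<in> A t})"
    if "n \<le> T" for n
    using that c
  proof (induction n arbitrary: c)
    case 0
    then show ?case by (simp add: harm_def)
  next
    case (Suc n)
    let ?J = "{t\<in>{1..n}. v \<in> A t}"
    show ?case
    proof (cases "v \<in> A (Suc n)")
      case False
      then have "{t\<in>{1..Suc n}. v \<in> A t} = ?J" by (auto simp: le_Suc_eq)
      then show ?thesis using Suc by simp
    next
      case True
      have J: "{t\<in>{1..Suc n}. v \<in> A t} = insert (Suc n) ?J" using True by auto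
      define m where "m = p (Suc n) v"
      have "{1..<Suc n} = {1..n}" by auto
      then have min: "is_arg_min (\<lambda>z. \<Sum>s\<in>?J. square_loss y s z) (\<lambda>z. z \<in> {0..1}) m"
        using ftl [unfolded follow_the_leader_def, rule_format, of "Suc n" v] True Suc.prems(1)
        by (simp add: m_def)
      then have m: "m \<in> {0..1}" by (simp add: is_arg_min_def)
      have convex: "(\<Sum>s\<in>?J. square_loss y s c) = (\<Sum>s\<in>?J. square_loss y s m) + card ?J / 2 * (c - m)\<^sup>2"
        using y Suc.prems by (intro leader_strong_convexity min) auto
      have IH: "(\<Sum>t\<in>?J. square_loss y t (p t v)) \<le> (\<Sum>t\<in>?J. square_loss y t m) + harm (card ?J)"
        using Suc m by simp
      define a where "a = y (Suc n) - m"
      define k where "k = real (card ?J) + 1"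
      have k: "0 < k" by (simp add: k_def)
      have "\<bar>a\<bar> \<le> 1" using m y [of "Suc n"] Suc.prems by (auto simp: a_def)
      then have a1: "a\<^sup>2 \<le> 1" by (simp add: abs_square_le_1)
      \<comment> \<open>The next claim is this inequality rearranged: a completed square, with slack
        supplied by \<open>a^2 \<le> 1\<close>.\<close>
      have "0 \<le> (k * (c - m) - a)\<^sup>2 + (1 - a\<^sup>2) + 1"
        using a1 zero_le_power2 [of "k * (c - m) - a"] by linarith
      then have "2 * k * (a * (c - m) - k / 2 * (c - m)\<^sup>2) \<le> 2 * k * (1 / k)"
        using k by (simp add: power2_eq_square algebra_simps)
      then have "a * (c - m) - k / 2 * (c - m)\<^sup>2 \<le> 1 / k"
        by (rule mult_left_le_imp_le) (use k in simp)
      moreover have "square_loss y (Suc n) m - square_loss y (Suc n) c = a * (c - m) - (c - m)\<^sup>2 / 2"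
        by (simp add: square_loss_def a_def power2_eq_square field_simps)
      ultimately have "square_loss y (Suc n) m - square_loss y (Suc n) c
          \<le> card ?J / 2 * (c - m)\<^sup>2 + 1 / k"
        by (simp add: k_def add_divide_distrib distrib_right)
      moreover have "harm (Suc (card ?J)) = harm (card ?J) + 1 / k"
        by (simp add: harm_Suc k_def inverse_eq_divide add.commute)
      ultimately show ?thesis unfolding J using IH convex by (simp add: m_def)
    qed
  qed
  then show ?thesis by simp
qed

section \<open>The net and its regret\<close>

text \<open>The radii stay abstract here, which separates the combinatorics of the net from the
  tuning of \<open>\<rho>\<close>.\<close>

locale propagated_net =
  fixes N :: "'a::real_vector \<Rightarrow> real" and \<rho> D T x S \<pi>
  assumes N: "is_norm N" and D: "1 \<le> D" and run: "propagate_run N \<rho> D T x S \<pi>"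
    and radius_nonneg: "\<And>k t. 0 \<le> \<rho> k t"
    and in_ball: "\<And>t. t \<in> {1..T} \<Longrightarrow> x t \<in> norm_ball N 0 1"
begin

lemma step:
  assumes "t \<in> {1..T}" "k \<in> {1..D}"
  shows "propagate_step N x t (parent_ball N \<rho> x \<pi> t k) (\<rho> k t) (S (t - 1) k) (S t k) (\<pi> t k)"
  using run assms by (auto simp: propagate_run_def)

lemma active_center:
  assumes "t \<in> {1..T}" "k \<in> {1..D}"
  shows "\<pi> t k \<in> S t k" "S (t - 1) k \<subseteq> S t k" "S t k \<subseteq> insert t (S (t - 1) k)"
  using step [OF assms] by (auto simp: propagate_step_def Let_def is_arg_min_def split: if_splits)

lemma active_dist:
  assumes "t \<in> {1..T}" "k \<in> {1..D}"
  shows "N (x t - x (\<pi> t k)) \<le> \<rho> k t"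
proof -
  \<comment> \<open>For the case that \<open>t\<close> becomes its own center, where the distance is
    \<open>N 0\<close>.\<close>
  have "N 0 = 0" using N unfolding is_norm_def by blast
  then have "N (x t - x t) \<le> \<rho> k t" using radius_nonneg by simp
  then show ?thesis using step [OF assms] by (auto simp: propagate_step_def Let_def)
qed

lemma centers_subset:
  assumes "k \<in> {1..D}" "t \<le> T"
  shows "S t k \<subseteq> {1..t}"
  using assms(2)
proof (induction t)
  case 0
  then show ?case using run assms(1) by (auto simp: propagate_run_def)
next
  case (Suc t)
  then show ?case using active_center(3) [of "Suc t" k] assms(1) by fastforce
qed

lemma centers_mono:
  assumes k: "k \<in> {1..D}" and "t \<le> t'" "t' \<le> T"
  shows "S t k \<subseteq> S t' k"
  using assms(2,3)
proof (induction t' rule: dec_induct)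
  case (step n)
  then show ?case using active_center(2) [of "Suc n" k] k by auto
qed auto

lemma active_center_final:
  assumes "t \<in> {1..T}" "k \<in> {1..D}"
  shows "\<pi> t k \<in> S T k"
  using active_center(1) [OF assms] centers_mono [OF assms(2), of t T] assms(1) by auto

text \<open>At level 1 the parent ball is the whole space, so, unlike at deeper levels, no existing
  center escapes the search and the net is a genuine packing.\<close>

lemma root_level_separated:
  assumes r: "\<And>t. t \<in> {1..T} \<Longrightarrow> r \<le> \<rho> 1 t"
    and "i \<in> S T 1" "j \<in> S T 1" "i \<noteq> j"
  shows "r < N (x i - x j)"
proof -
  have 1: "1 \<in> {1..D}" using D by simp
  have "\<forall>i\<in>S n 1. \<forall>j\<in>S n 1. i \<noteq> j \<longrightarrow> r < N (x i - x j)" if "n \<le> T" for n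
    using that
  proof (induction n)
    case 0
    then show ?case using centers_subset [OF 1, of 0] by auto
  next
    case (Suc n)
    let ?t = "Suc n"
    have t: "?t \<in> {1..T}" using Suc.prems by simp
    have IH: "\<forall>i\<in>S n 1. \<forall>j\<in>S n 1. i \<noteq> j \<longrightarrow> r < N (x i - x j)" using Suc by simp
    have old: "x i \<in> norm_ball N 0 1" if "i \<in> S n 1" for i
      using centers_subset [OF 1, of n] that Suc.prems by (intro in_ball) fastforce
    have "propagate_step N x ?t (norm_ball N 0 1) (\<rho> 1 ?t) (S n 1) (S ?t 1) (\<pi> ?t 1)"
      using step [OF t 1] by (simp add: parent_ball_def)
    \<comment> \<open>By \<open>old\<close>, every earlier center lies in the parent ball, so once a
      center exists a new one arises only if the nearest is farther than the radius.\<close>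
    then consider "S n 1 = {}" | "S ?t 1 = S n 1"
      | i where "is_arg_min (\<lambda>i. N (x i - x ?t)) (\<lambda>i. i \<in> S n 1 \<and> x i \<in> norm_ball N 0 1) i"
          "\<not> N (x ?t - x i) \<le> \<rho> 1 ?t"
      using old by (fastforce simp: propagate_step_def Let_def split: if_splits)
    then show ?case
    proof cases
      case 1
      then show ?thesis using active_center(3) [OF t \<open>1 \<in> {1..D}\<close>] by auto
    next
      case 2
      then show ?thesis using IH by simp
    next
      case (3 i)
      have far: "r < N (x j - x ?t)" if "j \<in> S n 1" for j
      proof -
        have "N (x i - x ?t) \<le> N (x j - x ?t)"
          using 3(1) that old [OF that] by (auto simp: is_arg_min_def not_less)
        then show ?thesis
          using 3(2) norm_minus_commute' [OF N, of "x i" "x ?t"] r [OF t] by simp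
      qed
      have "S ?t 1 \<subseteq> insert ?t (S n 1)" using active_center(3) [OF t 1] by simp
      then show ?thesis
        using IH far norm_minus_commute' [OF N, of _ "x ?t"] by (smt (verit) insert_iff subsetD)
    qed
  qed
  then show ?thesis using assms(2-4) by blast
qed

lemma finite_tree_nodes: "finite (tree_nodes D (S T))"
proof -
  have "tree_nodes D (S T) \<subseteq> insert Root (case_prod Node ` ({1..D} \<times> {1..T}))"
    using centers_subset [of _ T] by (fastforce simp: tree_nodes_def)
  then show ?thesis by (rule finite_subset) simp
qed

text \<open>The probabilities in \<open>leaf_level_pmf\<close> need a nonzero total; the leaf
  associated with round 1 is a witness. Finiteness matters because \<open>card\<close> of an
  infinite set is 0.\<close>

lemma num_leaves_nonzero:
  assumes T: "1 \<le> T" and E: "pruning (tree_nodes D (S T)) R E"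
    and leaf: "rounds_have_leaf D T \<pi> R E"
  shows "num_leaves D R E \<noteq> 0"
proof -
  have "E \<subseteq> tree_nodes D (S T)" using E by induction auto
  then have "finite E" using finite_tree_nodes finite_subset by blast
  then have "finite (leaves R E)" by (simp add: leaves_def)
  then have fin: "finite (leaves_at R E k)" for k
    unfolding leaves_at_def by (rule finite_vimageI [unfolded vimage_def]) (simp add: inj_on_def)
  obtain k where k: "k \<in> {1..D}" "Node k (\<pi> 1 k) \<in> leaves R E"
    using leaf [unfolded rounds_have_leaf_def, rule_format, of 1] T
    unfolding active_nodes_def by auto
  then have "\<pi> 1 k \<in> leaves_at R E k" by (simp add: leaves_at_def)
  then have "0 < card (leaves_at R E k)" using fin [of k] by (auto simp: card_gt_0_iff)
  also have "\<dots> \<le> num_leaves D R E"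
    unfolding num_leaves_def using k(1) by (intro member_le_sum) auto
  finally show ?thesis by simp
qed

text \<open>Regret splits into three telescoping gaps: aggregate against level-1 learner, that
  learner against the constant \<open>f\<close>-value at its center, and that value against
  \<open>f (x t)\<close>. The first two cost a logarithm per level-1 node, the third is the bias
  \<open>b\<close>.\<close>

lemma root_level_regret:
  assumes T: "1 \<le> T" and y: "\<And>t. t \<in> {1..T} \<Longrightarrow> y t \<in> {0..1}"
    and ftl: "follow_the_leader (square_loss y) (active_nodes D \<pi>) T q"
    and f: "\<And>t. t \<in> {1..T} \<Longrightarrow> f (x t) \<in> {0..1}"
    and bias: "\<And>t. t \<in> {1..T} \<Longrightarrow> \<bar>f (x (\<pi> t 1)) - f (x t)\<bar> \<le> b t"
  shows "(\<Sum>t=1..T. square_loss y t (hedge_prediction (square_loss y) (active_nodes D \<pi>) q t)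
            - square_loss y t (f (x t)))
    \<le> card (S T 1) * (2 * ln (real (D * T)) + 1 + ln T) + (\<Sum>t=1..T. b t)"
proof -
  let ?A = "active_nodes D \<pi>"
  let ?l = "square_loss y"
  define c where "c t = Node 1 (\<pi> t 1)" for t
  \<comment> \<open>\<open>P\<close> collects the visited level-1 nodes, which are the comparators;
    \<open>U\<close> collects all nodes ever active, which carry the total mass.\<close>
  define P where "P = c ` {1..T}"
  define U where "U = (\<Union>t\<in>{1..T}. ?A t)"
  have 1: "1 \<in> {1..D}" using D by simp
  have fin: "finite (?A t)" for t by (simp add: active_nodes_def)
  have cA: "c t \<in> ?A t" for t using 1 unfolding c_def active_nodes_def by blast
  have root_active: "v \<in> ?A t \<longleftrightarrow> c t = v" if "v \<in> P" for v t
  proof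
    show "c t = v" if "v \<in> ?A t"
      using that \<open>v \<in> P\<close> by (auto simp: P_def c_def active_nodes_def)
    show "v \<in> ?A t" if "c t = v" using cA [of t] that by simp
  qed
  have U: "finite U" "P \<subseteq> U" "\<And>t. t \<in> {1..T} \<Longrightarrow> ?A t \<subseteq> U"
    using fin cA by (auto simp: U_def P_def)
  have "card U \<le> (\<Sum>t\<in>{1..T}. card (?A t))"
    unfolding U_def by (rule card_UN_le) simp
  also have "\<dots> \<le> (\<Sum>t\<in>{1..T}. D)"
    by (intro sum_mono) (use card_image_le [of "{1..D}"] in \<open>simp add: active_nodes_def\<close>)
  finally have card_U: "card U \<le> D * T" by (simp add: mult.commute)
  have "c 1 \<in> U" using T U(2) by (auto simp: P_def)
  then have "0 < card U" using U(1) by (auto simp: card_gt_0_iff)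
  then have ln_U: "ln (card U) \<le> ln (real (D * T))"
    using card_U by (subst ln_le_cancel_iff) (simp_all only: of_nat_le_iff of_nat_0_less_iff)
  have root_center: "\<pi> t 1 \<in> {1..T}" if "t \<in> {1..T}" for t
    using active_center_final [OF that 1] centers_subset [OF 1 order_refl] by blast
  have "P \<subseteq> Node 1 ` S T 1"
    using active_center_final 1 by (auto simp: P_def c_def)
  then have card_P: "card P \<le> card (S T 1)"
    using centers_subset [OF 1 order_refl] finite_subset
    by (meson card_image_le card_mono dual_order.trans finite_atLeastAtMost finite_imageI)
  have "(\<Sum>t=1..T. ?l t (hedge_prediction ?l ?A q t) - ?l t (q t (c t))) \<le> 2 * real (card P) * ln (card U)"
  proof (rule hedge_regret [OF fin y _ _ _ U])
    show "q t u \<in> {0..1}" if "t \<in> {1..T}" "u \<in> ?A t" for t u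
      using ftl that unfolding follow_the_leader_def is_arg_min_def by blast
    show "?A t \<inter> P = {c t}" if "t \<in> {1..T}" for t
      using root_active that cA by (auto simp: P_def)
  qed (simp_all add: P_def)
  also have "\<dots> \<le> 2 * real (card P) * ln (real (D * T))" using ln_U by (intro mult_left_mono) auto
  finally have hedge: "(\<Sum>t=1..T. ?l t (hedge_prediction ?l ?A q t) - ?l t (q t (c t)))
      \<le> 2 * real (card P) * ln (real (D * T))" .
  \<comment> \<open>Grouping rounds by level-1 node makes the comparator constant within each group,
    as the regret bound of Follow-the-Leader requires.\<close>
  have "(\<Sum>t=1..T. ?l t (q t (c t)) - ?l t (f (x (\<pi> t 1))))
      = (\<Sum>v\<in>P. \<Sum>t\<in>{t\<in>{1..T}. c t = v}. ?l t (q t (c t)) - ?l t (f (x (\<pi> t 1))))"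
    by (rule sum.group [symmetric]) (auto simp: P_def)
  also have "\<dots> \<le> (\<Sum>v\<in>P. 1 + ln T)"
  proof (rule sum_mono)
    fix v assume v: "v \<in> P"
    then obtain s where s: "v = Node 1 s" "s \<in> {1..T}"
      using root_center by (auto simp: P_def c_def)
    let ?J = "{t\<in>{1..T}. v \<in> ?A t}"
    have "(\<Sum>t\<in>{t\<in>{1..T}. c t = v}. ?l t (q t (c t)) - ?l t (f (x (\<pi> t 1))))
        = (\<Sum>t\<in>?J. ?l t (q t v) - ?l t (f (x s)))"
      using root_active [OF v] s by (intro sum.cong) (auto simp: c_def)
    also have "\<dots> \<le> harm (card ?J)"
      using follow_the_leader_regret [OF y ftl f [OF s(2)], of v] by (simp add: sum_subtractf)
    also have "\<dots> \<le> harm T"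
    proof (rule harm_mono)
      have "card ?J \<le> card {1..T}" by (rule card_mono) auto
      then show "card ?J \<le> T" by simp
    qed
    also have "\<dots> \<le> 1 + ln T" using harm_le_ln T by simp
    finally show "(\<Sum>t\<in>{t\<in>{1..T}. c t = v}. ?l t (q t (c t)) - ?l t (f (x (\<pi> t 1)))) \<le> 1 + ln T" .
  qed
  finally have ftl': "(\<Sum>t=1..T. ?l t (q t (c t)) - ?l t (f (x (\<pi> t 1)))) \<le> card P * (1 + ln T)" by simp
  have "(\<Sum>t=1..T. ?l t (f (x (\<pi> t 1))) - ?l t (f (x t))) \<le> (\<Sum>t=1..T. b t)"
  proof (rule sum_mono)
    fix t assume t: "t \<in> {1..T}"
    show "?l t (f (x (\<pi> t 1))) - ?l t (f (x t)) \<le> b t"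
      using square_loss_diff_le [of y t "f (x (\<pi> t 1))" "f (x t)"] y [OF t] f [OF t]
        f [OF root_center [OF t]] bias [OF t] by linarith
  qed
  then have total: "(\<Sum>t=1..T. ?l t (hedge_prediction ?l ?A q t) - ?l t (f (x t)))
      \<le> card P * (2 * ln (real (D * T)) + 1 + ln T) + (\<Sum>t=1..T. b t)"
    using hedge ftl' by (simp add: sum_subtractf algebra_simps)
  have "card P * (2 * ln (real (D * T)) + 1 + ln T) \<le> card (S T 1) * (2 * ln (real (D * T)) + 1 + ln T)"
  proof (rule mult_right_mono)
    have "1 \<le> D * T" using D T by simp
    then have "0 \<le> ln (real (D * T))" by (simp del: of_nat_mult ln_mult)
    moreover have "0 \<le> ln T" using T by simp
    ultimately show "0 \<le> 2 * ln (real (D * T)) + 1 + ln T" by linarith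
  qed (use card_P in simp)
  then show ?thesis using total by linarith
qed

end

section \<open>Bias of a level-1 center through the leaf of the round\<close>

text \<open>Admissibility is required for the radii of all rounds \<open>t'\<close>, so \<open>f\<close> is almost Lipschitz
  around a leaf center at every scale above the final radius. A center of level 1 thus inherits the
  value of a leaf center at distance \<open>2 \<rho> 1 t\<close> by choosing \<open>t'\<close> with \<open>\<rho> k t'\<close> comparable to
  \<open>2 \<rho> 1 t\<close>; if no such round exists, \<open>\<rho> 1 t\<close> is bounded below.\<close>

lemma admissible_near_leaf:
  fixes L :: "nat \<Rightarrow> real"
  assumes N: "is_norm N" and a: "0 < a" "a \<le> 1"
    and f: "f \<in> admissible N (\<lambda>k t. (L k * real t) powr (- a)) L D T x R E"
    and k: "k \<in> {1..D}" and i: "i \<in> leaves_at R E k" and t: "t \<in> {1..T}"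
    and L: "0 < L 1" "L 1 \<le> L k"
    and balls: "x i \<in> norm_ball N 0 1" "x t \<in> norm_ball N 0 1" "w \<in> norm_ball N 0 1"
    and xi: "N (x t - x i) \<le> (L k * real t) powr (- a)"
    and xw: "N (x t - w) \<le> (L 1 * real t) powr (- a)"
  shows "\<bar>f w - f (x t)\<bar> \<le> (5 * L k + 2 * L k powr a) * (L 1 * real t) powr (- a)"
proof -
  let ?r = "\<lambda>k t. (L k * real t) powr (- a)"
  have Lk: "0 < L k" using L by simp
  have t1: "1 \<le> real t" using t by simp
  have adm: "\<bar>f (x i) - f z\<bar> \<le> L k * ?r k t'"
    if "t' \<in> {1..T}" "N (z - x i) \<le> ?r k t'" "z \<in> norm_ball N 0 1" for z t'
    using f k i that unfolding admissible_def norm_ball_def by blast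
  have range: "f z \<in> {0..1}" if "z \<in> norm_ball N 0 1" for z
    using f that unfolding admissible_def by blast
  have r_le: "?r k t \<le> ?r 1 t"
    using a L Lk t1 by (intro powr_mono2') auto
  have near: "\<bar>f (x i) - f (x t)\<bar> \<le> L k * ?r 1 t"
    using adm [OF t xi balls(2)] r_le Lk by (meson mult_left_mono less_imp_le order_trans)
  have wi: "N (w - x i) \<le> 2 * ?r 1 t"
    using norm_triangle_sub [OF N, of w "x i" "x t"] norm_minus_commute' [OF N, of w "x t"]
      xi xw r_le by simp
  \<comment> \<open>Multiplying time by \<open>c\<close> doubles a radius, as
    \<open>c powr (- a) = 2\<close>.\<close>
  define c where "c = (2::real) powr (- 1 / a)"
  have "c \<le> 2 powr 0" unfolding c_def using a by (intro powr_mono) auto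
  then have c: "0 < c" "c \<le> 1" "c powr (- a) = 2"
    using a by (auto simp: c_def powr_powr)
  \<comment> \<open>\<open>\<kappa>\<close> translates level-1 time into level-\<open>k\<close>
    time: the level-\<open>k\<close> radius at the real time \<open>\<kappa> * t\<close> is exactly
    \<open>2 * ?r 1 t\<close>. Since \<open>\<kappa> \<le> 1\<close>, the round chosen below stays
    in \<open>{1..T}\<close>, the range covered by admissibility.\<close>
  define \<kappa> where "\<kappa> = c * L 1 / L k"
  have \<kappa>: "0 < \<kappa>" "\<kappa> \<le> 1"
    using c L Lk mult_mono [of c 1 "L 1" "L k"] by (auto simp: \<kappa>_def field_simps)
  have scale: "L k * (\<kappa> * real t) = c * (L 1 * real t)" using Lk by (simp add: \<kappa>_def)
  have far: "\<bar>f (x i) - f w\<bar> \<le> (4 * L k + 2 * L k powr a) * ?r 1 t"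
  proof (cases "1 \<le> \<kappa> * real t")
    case True
    \<comment> \<open>Rounding down a number that is at least 1 at most halves it, so the radius
      grows by a factor of at most \<open>2 powr a \<le> 2\<close> and lies between
      \<open>2 * ?r 1 t\<close> and \<open>4 * ?r 1 t\<close>.\<close>
    define t' where "t' = nat \<lfloor>\<kappa> * real t\<rfloor>"
    have "real_of_int \<lfloor>\<kappa> * real t\<rfloor> = real t'" using True by (simp add: t'_def)
    then have t': "real t' \<le> \<kappa> * real t" "\<kappa> * real t < real t' + 1" by linarith+
    then have "0 < real t'" using True by linarith
    then have t'1: "1 \<le> t'" by simp
    have "\<kappa> * real t \<le> real t" using \<kappa> t1 by simp
    then have t'T: "t' \<in> {1..T}" using t t' t'1 by simp
    have "c * (L 1 * real t) \<ge> L k * real t'"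
      unfolding scale [symmetric] using t'(1) Lk by (intro mult_left_mono) auto
    then have "?r k t' \<ge> (c * (L 1 * real t)) powr (- a)"
      using a Lk t'1 by (intro powr_mono2') auto
    then have lower: "2 * ?r 1 t \<le> ?r k t'" using c L t1 by (simp add: powr_mult)
    have "L k * real t' \<ge> L k * (\<kappa> * real t / 2)"
      using t' t'1 Lk by (intro mult_left_mono) auto
    then have "L k * real t' \<ge> (1/2) * (c * (L 1 * real t))"
      using scale by simp
    then have "?r k t' \<le> ((1/2) * (c * (L 1 * real t))) powr (- a)"
      using a c L t1 by (intro powr_mono2') auto
    also have "\<dots> = (1/2) powr (- a) * (2 * ?r 1 t)"
      using c L t1 by (simp only: powr_mult)
    also have "\<dots> \<le> 2 * (2 * ?r 1 t)"
    proof (rule mult_right_mono)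
      have "(1/2::real) powr (- a) = 2 powr a" by (simp add: powr_minus powr_divide)
      also have "\<dots> \<le> 2 powr 1" using a by (intro powr_mono) auto
      finally show "(1/2::real) powr (- a) \<le> 2" by simp
    qed simp
    finally have upper: "?r k t' \<le> 4 * ?r 1 t" by simp
    have "\<bar>f (x i) - f w\<bar> \<le> L k * ?r k t'"
      using adm [OF t'T _ balls(3)] wi lower by simp
    also have "\<dots> \<le> L k * (4 * ?r 1 t)" using upper Lk by simp
    also have "\<dots> \<le> (4 * L k + 2 * L k powr a) * ?r 1 t" by (simp add: distrib_right)
    finally show ?thesis .
  next
    case False
    \<comment> \<open>Here \<open>?r 1 t\<close> is at least \<open>L k powr (- a) / 2\<close>, so
      the trivial bound 1 on differences of \<open>f\<close>-values suffices; this is the source of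
      the summand \<open>2 * L k powr a\<close>.\<close>
    then have "L k * (\<kappa> * real t) \<le> L k" using Lk by simp
    then have "L k powr (- a) \<le> (c * (L 1 * real t)) powr (- a)"
      using a c L t1 unfolding scale by (intro powr_mono2') auto
    also have "\<dots> = 2 * ?r 1 t" using c L t1 by (simp only: powr_mult)
    finally have "L k powr a * L k powr (- a) \<le> L k powr a * (2 * ?r 1 t)"
      by (intro mult_left_mono) auto
    then have "1 \<le> 2 * L k powr a * ?r 1 t" using Lk by (simp flip: powr_add)
    also have "\<dots> \<le> (4 * L k + 2 * L k powr a) * ?r 1 t" using Lk by (simp add: distrib_right)
    finally show ?thesis using range [OF balls(1)] range [OF balls(3)] by auto
  qed
  have "\<bar>f w - f (x t)\<bar> \<le> \<bar>f (x i) - f w\<bar> + \<bar>f (x i) - f (x t)\<bar>" by linarith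
  then show ?thesis using near far by (simp add: algebra_simps)
qed

section \<open>Assembly of the bound in \<open>T\<close>\<close>

lemma sum_radii_le:
  assumes "0 < l" "a \<le> 1" "1 \<le> T"
  shows "(\<Sum>t=1..T. (l * real t) powr (- a)) \<le> l powr (- a) * real T powr (1 - a) * (1 + ln (real T))"
proof -
  have "(\<Sum>t=1..T. (l * real t) powr (- a)) \<le> (\<Sum>t=1..T. l powr (- a) * real T powr (1 - a) * inverse (real t))"
  proof (rule sum_mono)
    fix t assume t: "t \<in> {1..T}"
    \<comment> \<open>Splitting off \<open>1 / t\<close> and bounding the remaining power by its
      value at \<open>T\<close> leaves a harmonic sum, which costs one logarithm.\<close>
    then have "real t powr (- a) = real t powr (1 - a) * inverse (real t)"
      using powr_add [of "real t" "1 - a" "-1"] by (simp add: powr_minus)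
    also have "\<dots> \<le> real T powr (1 - a) * inverse (real t)"
      using t assms by (intro mult_right_mono powr_mono2) auto
    finally show "(l * real t) powr (- a) \<le> l powr (- a) * real T powr (1 - a) * inverse (real t)"
      using assms by (simp add: powr_mult mult.assoc mult_left_mono)
  qed
  also have "\<dots> = l powr (- a) * real T powr (1 - a) * harm T"
    by (simp add: harm_def sum_distrib_left)
  also have "\<dots> \<le> l powr (- a) * real T powr (1 - a) * (1 + ln (real T))"
    using harm_le_ln [OF assms(3)] by (intro mult_left_mono) auto
  finally show ?thesis .
qed

text \<open>All mass sits on the levels \<open>{1..D}\<close>. With
  \<open>m = L 1 powr (d / (d + 1))\<close> this bounds the expectation from below independently of
  the pruning.\<close>

lemma leaf_level_expectation_ge:
  fixes g :: "nat \<Rightarrow> real"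
  assumes "num_leaves D R E \<noteq> 0" and g: "\<And>k. k \<in> {1..D} \<Longrightarrow> m \<le> g k"
  shows "m \<le> measure_pmf.expectation (leaf_level_pmf D R E) g"
proof -
  let ?p = "leaf_level_pmf D R E"
  have sub: "set_pmf ?p \<subseteq> {1..D}"
    by (auto simp: set_pmf_eq pmf_leaf_level_pmf [OF assms(1)] split: if_splits)
  then have "finite (set_pmf ?p)" by (rule finite_subset) simp
  then have "measure_pmf.expectation ?p (\<lambda>_. m) \<le> measure_pmf.expectation ?p g"
    using sub g by (intro integral_mono_AE integrable_measure_pmf_finite) (auto simp: AE_measure_pmf_iff)
  then show ?thesis by simp
qed

text \<open>The count of level-1 centers and the summed biases each contribute order
  \<open>T powr (d / (d + 1)) * ln T\<close>. The factor depending on \<open>L\<close> is kept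
  explicit because the choice of \<open>T0\<close> refers to it.\<close>

lemma regret_le_root_level:
  fixes N :: "real ^ 'n \<Rightarrow> real" and L :: "nat \<Rightarrow> real" and S
  defines "d \<equiv> real CARD('n)"
  defines "\<rho> \<equiv> \<lambda>k t. (L k * real t) powr (- 1 / (d + 1))"
  assumes N: "is_norm N" and D: "D \<ge> 1" and L: "\<forall>k\<in>{1..D}. 0 < L k" "strict_mono_on {1..D} L"
    and G: "0 < G"
    and packing: "\<And>r (x :: nat \<Rightarrow> real ^ 'n) C. \<lbrakk>0 < r; r \<le> 1; \<And>i. i \<in> C \<Longrightarrow> N (x i) \<le> 1;
       \<And>i j. \<lbrakk>i \<in> C; j \<in> C; i \<noteq> j\<rbrakk> \<Longrightarrow> r < N (x i - x j)\<rbrakk>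
       \<Longrightarrow> real (card C) \<le> (G / r) ^ CARD('n)"
    and T: "3 \<le> T" "D \<le> T" "1 \<le> L 1 * real T"
    and xy: "\<forall>t\<in>{1..T}. x t \<in> norm_ball N 0 1 \<and> y t \<in> {0..1}"
    and run: "propagate_run N \<rho> D T x S \<pi>"
    and ftl: "follow_the_leader (square_loss y) (active_nodes D \<pi>) T q"
    and leaf: "rounds_have_leaf D T \<pi> R E"
    and f: "f \<in> admissible N \<rho> L D T x R E"
  shows "(\<Sum>t=1..T. square_loss y t (hedge_prediction (square_loss y) (active_nodes D \<pi>) q t)
            - square_loss y t (f (x t)))
    \<le> (6 * G ^ CARD('n) * L 1 powr (d / (d + 1))
         + 2 * (5 * L D + 2 * L D powr (1 / (d + 1))) * L 1 powr (- 1 / (d + 1)))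
       * (real T powr (d / (d + 1)) * ln (real T))"
proof -
  define a where "a = 1 / (d + 1)"
  have d: "1 \<le> d" using zero_less_card_finite [where 'a = 'n] unfolding d_def
    by (metis One_nat_def Suc_leI of_nat_1 of_nat_mono)
  have a: "0 < a" "a \<le> 1" using d by (auto simp: a_def)
  have a_eq: "- 1 / (d + 1) = - a" "d / (d + 1) = 1 - a" "1 / (d + 1) = a"
    using d by (auto simp: a_def field_simps)
  \<comment> \<open>The balance behind the radius exponent: the bound on the number of centers, of
    order \<open>T powr (a * d)\<close>, matches the summed radii, of order
    \<open>T powr (1 - a)\<close> up to a logarithm.\<close>
  have ad: "a * d = 1 - a" using d by (simp add: a_def field_simps)
  have \<rho>_eq: "\<rho> = (\<lambda>k t. (L k * real t) powr (- a))" unfolding \<rho>_def a_eq ..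
  have 1: "1 \<in> {1..D}" using D by simp
  have L1: "0 < L 1" using L(1) 1 by blast
  have L_mono: "L j \<le> L k" if "j \<in> {1..D}" "k \<in> {1..D}" "j \<le> k" for j k
    using strict_mono_on_leD [OF L(2) that] .
  interpret propagated_net N \<rho> D T x S \<pi>
    by unfold_locales (use N D run xy in \<open>auto simp: \<rho>_def\<close>)
  \<comment> \<open>Taken at the largest \<open>L k\<close>, so that it dominates the constant at
    whichever level the leaf of a round lies.\<close>
  define B where "B = 5 * L D + 2 * L D powr a"
  have LD: "0 < L D" using L(1) D by auto
  then have B: "0 \<le> B" by (simp add: B_def)
  have lnT: "1 \<le> ln (real T)"
  proof -
    have "exp 1 \<le> real T" using exp_le T(1) by linarith
    then show ?thesis using T(1) by (subst ln_ge_iff) auto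
  qed
  have radius: "\<rho> 1 T \<le> \<rho> 1 t" if "t \<in> {1..T}" for t
    unfolding \<rho>_eq using a L1 that by (intro powr_mono2') auto
  have bias: "\<bar>f (x (\<pi> t 1)) - f (x t)\<bar> \<le> B * \<rho> 1 t" if t: "t \<in> {1..T}" for t
  proof -
    have center: "x (\<pi> t k) \<in> norm_ball N 0 1" if "k \<in> {1..D}" for k
      using active_center_final [OF t that] centers_subset [OF that order_refl] by (intro in_ball) blast
    obtain k where k: "k \<in> {1..D}" "Node k (\<pi> t k) \<in> leaves R E"
      using leaf t unfolding rounds_have_leaf_def active_nodes_def by blast
    have L1k: "L 1 \<le> L k" using L_mono 1 k(1) by simp
    have "\<bar>f (x (\<pi> t 1)) - f (x t)\<bar> \<le> (5 * L k + 2 * L k powr a) * (L 1 * real t) powr (- a)"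
    proof (rule admissible_near_leaf [OF N a _ k(1) _ t L1 L1k])
      show "f \<in> admissible N (\<lambda>k t. (L k * real t) powr (- a)) L D T x R E"
        using f by (simp only: \<rho>_eq)
      show "\<pi> t k \<in> leaves_at R E k" using k(2) by (simp add: leaves_at_def)
      show "N (x t - x (\<pi> t k)) \<le> (L k * real t) powr (- a)"
        using active_dist [OF t k(1)] by (simp only: \<rho>_eq)
      show "N (x t - x (\<pi> t 1)) \<le> (L 1 * real t) powr (- a)"
        using active_dist [OF t 1] by (simp only: \<rho>_eq)
    qed (use center 1 k(1) in_ball [OF t] in auto)
    also have "\<dots> \<le> B * (L 1 * real t) powr (- a)"
      using L_mono [OF k(1), of D] k(1) D L1 L1k a
      by (intro mult_right_mono) (auto simp: B_def intro!: add_mono powr_mono2)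
    finally show ?thesis by (simp only: \<rho>_eq)
  qed
  have card: "card (S T 1) \<le> G ^ CARD('n) * L 1 powr (1 - a) * real T powr (1 - a)"
  proof -
    have "real (card (S T 1)) \<le> (G / \<rho> 1 T) ^ CARD('n)"
    proof (rule packing)
      show "0 < \<rho> 1 T" using T(1) L1 by (simp add: \<rho>_eq)
      \<comment> \<open>\<open>1 \<le> L 1 * T\<close> enters here, since \<open>packing\<close>
        covers only radii up to 1.\<close>
      have "(L 1 * real T) powr (- a) \<le> (L 1 * real T) powr 0"
        using T(3) a by (intro powr_mono) auto
      then show "\<rho> 1 T \<le> 1" using T(1) L1 by (simp add: \<rho>_eq)
      show "N (x i) \<le> 1" if "i \<in> S T 1" for i
        using in_ball centers_subset [OF 1 order_refl] that by (auto simp: norm_ball_def)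
      show "\<rho> 1 T < N (x i - x j)" if "i \<in> S T 1" "j \<in> S T 1" "i \<noteq> j" for i j
        using root_level_separated [OF radius that] .
    qed
    also have "G / \<rho> 1 T = G * (L 1 * real T) powr a"
      by (simp add: \<rho>_eq powr_minus divide_inverse)
    also have "\<dots> ^ CARD('n) = G ^ CARD('n) * (L 1 * real T) powr (a * d)"
      using T(1) L1 by (simp add: power_mult_distrib d_def powr_powr flip: powr_realpow)
    also have "\<dots> = G ^ CARD('n) * L 1 powr (1 - a) * real T powr (1 - a)"
      using L1 by (simp add: ad powr_mult)
    finally show ?thesis .
  qed
  \<comment> \<open>\<open>D \<le> T\<close> removes \<open>D\<close> from the logarithm; with
    \<open>1 \<le> ln T\<close>, \<open>2 * 2 + 1 + 1\<close> gives the factor 6.\<close>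
  have "ln (real (D * T)) \<le> ln (real (T * T))"
    using D T by (subst ln_le_cancel_iff) (auto simp flip: of_nat_mult)
  also have "\<dots> = 2 * ln (real T)" using T by (simp add: ln_mult)
  finally have logs: "2 * ln (real (D * T)) + 1 + ln T \<le> 6 * ln T" using lnT by linarith
  have "(\<Sum>t=1..T. square_loss y t (hedge_prediction (square_loss y) (active_nodes D \<pi>) q t)
            - square_loss y t (f (x t)))
      \<le> card (S T 1) * (2 * ln (real (D * T)) + 1 + ln T) + (\<Sum>t=1..T. B * \<rho> 1 t)"
  proof (rule root_level_regret [OF _ _ ftl])
    show "f (x t) \<in> {0..1}" if "t \<in> {1..T}" for t
      using f in_ball [OF that] unfolding admissible_def by blast
  qed (use T xy bias in auto)
  also have "\<dots> \<le> (G ^ CARD('n) * L 1 powr (1 - a) * real T powr (1 - a)) * (6 * ln T)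
      + B * (L 1 powr (- a) * real T powr (1 - a) * (2 * ln T))"
  proof (rule add_mono)
    show "card (S T 1) * (2 * ln (real (D * T)) + 1 + ln T)
        \<le> (G ^ CARD('n) * L 1 powr (1 - a) * real T powr (1 - a)) * (6 * ln T)"
    proof (rule order_trans [OF mult_left_mono [OF logs] mult_right_mono [OF card]])
    qed (use lnT in auto)
    have "(\<Sum>t=1..T. \<rho> 1 t) \<le> L 1 powr (- a) * real T powr (1 - a) * (1 + ln (real T))"
      unfolding \<rho>_eq using sum_radii_le [OF L1 a(2), of T] T(1) by simp
    also have "\<dots> \<le> L 1 powr (- a) * real T powr (1 - a) * (2 * ln T)"
      using lnT by (intro mult_left_mono) auto
    finally show "(\<Sum>t=1..T. B * \<rho> 1 t) \<le> B * (L 1 powr (- a) * real T powr (1 - a) * (2 * ln T))"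
      using B by (simp add: mult_left_mono flip: sum_distrib_left)
  qed
  also have "\<dots> = (6 * G ^ CARD('n) * L 1 powr (1 - a) + 2 * B * L 1 powr (- a)) * (real T powr (1 - a) * ln T)"
    by (simp add: algebra_simps)
  finally show ?thesis unfolding a_eq B_def .
qed

theorem theorem1:
  fixes N :: "real ^ 'n \<Rightarrow> real" and D :: nat
  assumes "is_norm N" and "D \<ge> 1"
  shows
    "\<exists>(C::real) (p::nat). \<forall>L::nat \<Rightarrow> real.
       (\<forall>k\<in>{1..D}. 0 < L k) \<and> strict_mono_on {1..D} L \<longrightarrow>
       (\<exists>T0. \<forall>T\<ge>T0. \<forall>(x :: nat \<Rightarrow> real ^ 'n) (y :: nat \<Rightarrow> real) S \<pi> q E f.
          let d = real CARD('n);
              \<rho> = (\<lambda>k t. (L k * real t) powr (- 1 / (d + 1)));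
              \<l> = square_loss y;
              A = active_nodes D \<pi>;
              V = tree_nodes D (S T);
              R = tree_edges D (S T) \<pi>
          in (\<forall>t\<in>{1..T}. x t \<in> norm_ball N 0 1 \<and> y t \<in> {0..1}) \<and>
             propagate_run N \<rho> D T x S \<pi> \<and>
             follow_the_leader \<l> A T q \<and>
             pruning V R E \<and> rounds_have_leaf D T \<pi> R E \<and>
             f \<in> admissible N \<rho> L D T x R E \<longrightarrow>
             (\<Sum>t=1..T. \<l> t (hedge_prediction \<l> A q t) - \<l> t (f (x t)))
               \<le> C * ln (real T) ^ p *
                  (measure_pmf.expectation (leaf_level_pmf D R E) (\<lambda>k. L k powr (d / (d + 1)))
                     * real T powr (d / (d + 1)) +
                   (\<Sum>k=1..D. (L k * real (rounds_at_level D T \<pi> R E k)) powr (d / (d + 1)))))"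
proof -
  obtain G where G: "0 < G"
    and packing: "\<And>r (x :: nat \<Rightarrow> real ^ 'n) C. \<lbrakk>0 < r; r \<le> 1; \<And>i. i \<in> C \<Longrightarrow> N (x i) \<le> 1;
       \<And>i j. \<lbrakk>i \<in> C; j \<in> C; i \<noteq> j\<rbrakk> \<Longrightarrow> r < N (x i - x j)\<rbrakk>
       \<Longrightarrow> real (card C) \<le> (G / r) ^ CARD('n)"
    using packing_bound [OF assms(1), where 'i = nat] by (metis DIM_cart DIM_real mult.right_neutral)
  define d where "d = real CARD('n)"
  show ?thesis
  \<comment> \<open>\<open>C = 1\<close> and \<open>p = 2\<close> are fixed before \<open>L\<close>:
    one logarithm comes from the regret bound, the other outgrows the factor depending on
    \<open>L\<close>.\<close>
  proof (rule exI [of _ 1], rule exI [of _ 2], intro allI impI, elim conjE)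
    fix L :: "nat \<Rightarrow> real"
    assume L: "\<forall>k\<in>{1..D}. 0 < L k" "strict_mono_on {1..D} L"
    have L1: "0 < L 1" using L(1) assms(2) by auto
    define H where "H = 6 * G ^ CARD('n) * L 1 powr (d / (d + 1))
        + 2 * (5 * L D + 2 * L D powr (1 / (d + 1))) * L 1 powr (- 1 / (d + 1))"
    \<comment> \<open>\<open>T0\<close> may depend on \<open>L\<close>, so one of the two logarithms pays for the constant \<open>H\<close>.\<close>
    define T0 where "T0 = max (max 3 D) (nat \<lceil>max (1 / L 1) (exp (H / L 1 powr (d / (d + 1))))\<rceil>)"
    have main: "(\<Sum>t=1..T. square_loss y t (hedge_prediction (square_loss y) (active_nodes D \<pi>) q t)
          - square_loss y t (f (x t)))
        \<le> 1 * ln (real T) ^ 2 *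
          (measure_pmf.expectation (leaf_level_pmf D R E) (\<lambda>k. L k powr (d / (d + 1)))
             * real T powr (d / (d + 1)) +
           (\<Sum>k=1..D. (L k * real (rounds_at_level D T \<pi> R E k)) powr (d / (d + 1))))"
      if T: "T \<ge> T0"
        and xy: "\<forall>t\<in>{1..T}. x t \<in> norm_ball N 0 1 \<and> y t \<in> {0..1}"
        and run: "propagate_run N (\<lambda>k t. (L k * real t) powr (- 1 / (d + 1))) D T x S \<pi>"
        and ftl: "follow_the_leader (square_loss y) (active_nodes D \<pi>) T q"
        and E: "pruning (tree_nodes D (S T)) R E" and leaf: "rounds_have_leaf D T \<pi> R E"
        and f: "f \<in> admissible N (\<lambda>k t. (L k * real t) powr (- 1 / (d + 1))) L D T x R E"
      for T and x :: "nat \<Rightarrow> real ^ 'n" and y :: "nat \<Rightarrow> real" and S \<pi> q R E f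
    proof -
      let ?b = "d / (d + 1)"
      have b: "0 \<le> ?b" by (simp add: d_def)
      have "3 \<le> T" "D \<le> T" and large: "max (1 / L 1) (exp (H / L 1 powr ?b)) \<le> real T"
        using T by (auto simp: T0_def)
      have "1 \<le> L 1 * real T" using large L1 by (simp add: field_simps)
      have "exp (H / L 1 powr ?b) \<le> real T" using large by simp
      then have "H / L 1 powr ?b \<le> ln (real T)" using \<open>3 \<le> T\<close> by (subst ln_ge_iff) auto
      then have H: "H \<le> L 1 powr ?b * ln (real T)" using L1 by (simp add: field_simps)
      have lnT: "0 \<le> ln (real T)" using \<open>3 \<le> T\<close> by simp
      interpret propagated_net N "\<lambda>k t. (L k * real t) powr (- 1 / (d + 1))" D T x S \<pi>
        by unfold_locales (use assms xy run in auto)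
      let ?e = "measure_pmf.expectation (leaf_level_pmf D R E) (\<lambda>k. L k powr ?b)"
      have e: "L 1 powr ?b \<le> ?e"
      proof (rule leaf_level_expectation_ge)
        show "num_leaves D R E \<noteq> 0" using num_leaves_nonzero [OF _ E leaf] \<open>3 \<le> T\<close> by simp
        show "L 1 powr ?b \<le> L k powr ?b" if "k \<in> {1..D}" for k
          using strict_mono_on_leD [OF L(2), of 1 k] that assms(2) L1 b by (intro powr_mono2) auto
      qed
      have "(\<Sum>t=1..T. square_loss y t (hedge_prediction (square_loss y) (active_nodes D \<pi>) q t)
          - square_loss y t (f (x t))) \<le> H * (real T powr ?b * ln (real T))"
        unfolding H_def d_def
        by (rule regret_le_root_level [OF assms L G packing \<open>3 \<le> T\<close> \<open>D \<le> T\<close> \<open>1 \<le> L 1 * real T\<close> xy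
              run [unfolded d_def] ftl leaf f [unfolded d_def]])
      also have "\<dots> \<le> (L 1 powr ?b * ln (real T)) * (real T powr ?b * ln (real T))"
        using H lnT by (intro mult_right_mono) auto
      also have "\<dots> = ln (real T) ^ 2 * (L 1 powr ?b * real T powr ?b)"
        by (simp add: power2_eq_square)
      also have "\<dots> \<le> ln (real T) ^ 2 * (?e * real T powr ?b +
          (\<Sum>k=1..D. (L k * real (rounds_at_level D T \<pi> R E k)) powr ?b))"
        using e by (intro mult_left_mono add_increasing2 mult_right_mono sum_nonneg) auto
      finally show ?thesis by simp
    qed
    show "\<exists>T0. \<forall>T\<ge>T0. \<forall>(x :: nat \<Rightarrow> real ^ 'n) (y :: nat \<Rightarrow> real) S \<pi> q E f.
          let d = real CARD('n);
              \<rho> = (\<lambda>k t. (L k * real t) powr (- 1 / (d + 1)));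
              \<l> = square_loss y;
              A = active_nodes D \<pi>;
              V = tree_nodes D (S T);
              R = tree_edges D (S T) \<pi>
          in (\<forall>t\<in>{1..T}. x t \<in> norm_ball N 0 1 \<and> y t \<in> {0..1}) \<and>
             propagate_run N \<rho> D T x S \<pi> \<and>
             follow_the_leader \<l> A T q \<and>
             pruning V R E \<and> rounds_have_leaf D T \<pi> R E \<and>
             f \<in> admissible N \<rho> L D T x R E \<longrightarrow>
             (\<Sum>t=1..T. \<l> t (hedge_prediction \<l> A q t) - \<l> t (f (x t)))
               \<le> 1 * ln (real T) ^ 2 *
                  (measure_pmf.expectation (leaf_level_pmf D R E) (\<lambda>k. L k powr (d / (d + 1)))
                     * real T powr (d / (d + 1)) +
                   (\<Sum>k=1..D. (L k * real (rounds_at_level D T \<pi> R E k)) powr (d / (d + 1))))"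
      unfolding Let_def
      by (rule exI [of _ T0], intro allI impI, elim conjE, rule main [unfolded d_def])
  qed
qed

end
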